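(* The almost Hermitian manifold $(\mathbb{C}P^3,g_a,J)$ is quasi-Kähler for all $a>0$, and it is nearly Kähler if and only if $a=2$. It is not Kähler for any $a>0$.
   Context: Identify $\mathbb{R}^8\cong\mathbb{C}^4\cong\mathbb{H}^2$ via $(z_1,z_2,z_3,z_4)\leftrightarrow(z_1+z_2j,\,z_3+z_4j)$ and let $i,j,k$ act by left multiplication. Let $\pi:\mathbb{S}^7\subset\mathbb{C}^4\to\mathbb{C}P^3$ be the Hopf fibration (vertical space at $q$ spanned by $iq$), $g_1$ the Fubini–Study metric for which $\pi$ is a Riemannian submersion from the round sphere of constant curvature $1$, $J_1$ the standard complex structure. Define $\mathcal{D}_1^2(\pi(q))=d\pi_q(\mathrm{span}\{jq,kq\})$, $\mathcal{D}_2^4(\pi(q))=d\pi_q(\mathrm{span}\{iq,jq,kq\}^\perp)$ (complement in $T_q\mathbb{S}^7$); these are well defined and $T\mathbb{C}P^3=\mathcal{D}_1^2\oplus\mathcal{D}_2^4$ is $g_1$-orthogonal. Let $J=-J_1$ on $\mathcal{D}_1^2$, $J=J_1$ on $\mathcal{D}_2^4$. For $a>0$, $g_a$ equals $g_1$ on $\mathcal{D}_1^2\times\mathcal{D}_1^2$, $a\,g_1$ on $\mathcal{D}_2^4\times\mathcal{D}_2^4$ and $0$ on $\mathcal{D}_1^2\times\mathcal{D}_2^4$; $\nabla^a$ is its Levi-Civita connection. An almost Hermitian manifold $(M,g,J)$ with Levi-Civita connection $\nabla$ is quasi-Kähler if $(\nabla_XJ)Y+(\nabla_{JX}J)JY=0$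 for all $X,Y$, nearly Kähler if $(\nabla_XJ)Y=-(\nabla_YJ)X$ for all $X,Y$, and Kähler if $\nabla J=0$. *)

theory Defs
  imports "HOL-Analysis.Analysis" "HOL-Library.Function_Algebras"
begin

section \<open>Smooth maps between Euclidean spaces\<close>

primrec Ck_on :: "nat \<Rightarrow> 'a::euclidean_space set \<Rightarrow> ('a \<Rightarrow> 'b::real_normed_vector) \<Rightarrow> bool" where
  "Ck_on 0 S f \<longleftrightarrow> continuous_on S f"
| "Ck_on (Suc k) S f \<longleftrightarrow> (\<forall>x\<in>S. f differentiable (at x)) \<and>
     (\<forall>v. Ck_on k S (\<lambda>x. frechet_derivative f (at x) v))"

text \<open>Meant for open \<open>S\<close>.\<close>

definition smooth_on :: "'a::euclidean_space set \<Rightarrow> ('a \<Rightarrow> 'b::real_normed_vector) \<Rightarrow> bool" where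
  "smooth_on S f \<longleftrightarrow> (\<forall>k. Ck_on k S f)"


section \<open>Almost Hermitian manifolds\<close>

text \<open>
  A smooth manifold is given by its type of points \<open>'m\<close> together with the algebra \<open>F\<close> of its
  smooth real functions. A tangent vector is the velocity of a smooth curve, regarded as an
  operator on \<open>F\<close>; as the operators are total, they take the value \<open>0\<close> outside \<open>F\<close>, so that two
  tangent vectors are equal as HOL functions iff they agree on \<open>F\<close>. Addition, subtraction and
  zero of tangent vectors and of vector fields are the pointwise ones.
\<close>

type_synonym 'm tvec = "('m \<Rightarrow> real) \<Rightarrow> real"
type_synonym 'm vfield = "'m \<Rightarrow> 'm tvec"
type_synonym 'm metric = "'m \<Rightarrow> 'm tvec \<Rightarrow> 'm tvec \<Rightarrow> real"
type_synonym 'm endo = "'m \<Rightarrow> 'm tvec \<Rightarrow> 'm tvec"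
type_synonym 'm connection = "'m vfield \<Rightarrow> 'm vfield \<Rightarrow> 'm vfield"

definition smooth_curve :: "('m \<Rightarrow> real) set \<Rightarrow> (real \<Rightarrow> 'm) \<Rightarrow> bool" where
  "smooth_curve F \<gamma> \<longleftrightarrow> (\<forall>f\<in>F. smooth_on UNIV (\<lambda>t. f (\<gamma> t)))"

definition velocity :: "('m \<Rightarrow> real) set \<Rightarrow> (real \<Rightarrow> 'm) \<Rightarrow> 'm tvec" where
  "velocity F \<gamma> = (\<lambda>f. if f \<in> F then deriv (\<lambda>t. f (\<gamma> t)) 0 else 0)"

definition tangent_space :: "('m \<Rightarrow> real) set \<Rightarrow> 'm \<Rightarrow> 'm tvec set" where
  "tangent_space F p = {velocity F \<gamma> | \<gamma>. smooth_curve F \<gamma> \<and> \<gamma> 0 = p}"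

definition vfields :: "('m \<Rightarrow> real) set \<Rightarrow> 'm vfield set" where
  "vfields F = {X. (\<forall>p. X p \<in> tangent_space F p) \<and> (\<forall>f\<in>F. (\<lambda>p. X p f) \<in> F)}"

definition tscale :: "real \<Rightarrow> 'm tvec \<Rightarrow> 'm tvec" where
  "tscale c u = (\<lambda>f. c * u f)"

definition vscale :: "('m \<Rightarrow> real) \<Rightarrow> 'm vfield \<Rightarrow> 'm vfield" where
  "vscale h X = (\<lambda>p. tscale (h p) (X p))"

definition bracket :: "'m vfield \<Rightarrow> 'm vfield \<Rightarrow> 'm vfield" where
  "bracket X Y = (\<lambda>p f. X p (\<lambda>q. Y q f) - Y p (\<lambda>q. X q f))"

definition inner_field :: "'m metric \<Rightarrow> 'm vfield \<Rightarrow> 'm vfield \<Rightarrow> 'm \<Rightarrow> real" where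
  "inner_field g X Y = (\<lambda>p. g p (X p) (Y p))"

definition app_endo :: "'m endo \<Rightarrow> 'm vfield \<Rightarrow> 'm vfield" where
  "app_endo J X = (\<lambda>p. J p (X p))"

definition riemannian_metric :: "('m \<Rightarrow> real) set \<Rightarrow> 'm metric \<Rightarrow> bool" where
  "riemannian_metric F g \<longleftrightarrow>
     (\<forall>p. \<forall>u\<in>tangent_space F p. \<forall>v\<in>tangent_space F p. \<forall>w\<in>tangent_space F p. \<forall>c.
        g p u v = g p v u \<and>
        g p (u + v) w = g p u w + g p v w \<and>
        g p (tscale c u) w = c * g p u w \<and>
        (u \<noteq> 0 \<longrightarrow> g p u u > 0)) \<and>
     (\<forall>X\<in>vfields F. \<forall>Y\<in>vfields F. inner_field g X Y \<in> F)"

definition almost_complex_structure :: "('m \<Rightarrow> real) set \<Rightarrow> 'm endo \<Rightarrow> bool" where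
  "almost_complex_structure F J \<longleftrightarrow>
     (\<forall>p. \<forall>u\<in>tangent_space F p. \<forall>v\<in>tangent_space F p. \<forall>c.
        J p u \<in> tangent_space F p \<and>
        J p (u + v) = J p u + J p v \<and>
        J p (tscale c u) = tscale c (J p u) \<and>
        J p (J p u) = - u) \<and>
     (\<forall>X\<in>vfields F. app_endo J X \<in> vfields F)"

definition almost_hermitian :: "('m \<Rightarrow> real) set \<Rightarrow> 'm metric \<Rightarrow> 'm endo \<Rightarrow> bool" where
  "almost_hermitian F g J \<longleftrightarrow>
     riemannian_metric F g \<and> almost_complex_structure F J \<and>
     (\<forall>p. \<forall>u\<in>tangent_space F p. \<forall>v\<in>tangent_space F p. g p (J p u) (J p v) = g p u v)"

definition affine_connection :: "('m \<Rightarrow> real) set \<Rightarrow> 'm connection \<Rightarrow> bool" where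
  "affine_connection F D \<longleftrightarrow>
     (\<forall>X\<in>vfields F. \<forall>Y\<in>vfields F. \<forall>Z\<in>vfields F. \<forall>h\<in>F.
        D X Y \<in> vfields F \<and>
        D (X + Y) Z = D X Z + D Y Z \<and>
        D (vscale h X) Z = vscale h (D X Z) \<and>
        D X (Y + Z) = D X Y + D X Z \<and>
        D X (vscale h Y) = vscale (\<lambda>p. X p h) Y + vscale h (D X Y))"

definition is_levi_civita :: "('m \<Rightarrow> real) set \<Rightarrow> 'm metric \<Rightarrow> 'm connection \<Rightarrow> bool" where
  "is_levi_civita F g D \<longleftrightarrow>
     affine_connection F D \<and>
     (\<forall>X\<in>vfields F. \<forall>Y\<in>vfields F. D X Y - D Y X = bracket X Y) \<and>
     (\<forall>X\<in>vfields F. \<forall>Y\<in>vfields F. \<forall>Z\<in>vfields F. \<forall>p.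
        X p (inner_field g Y Z) = g p (D X Y p) (Z p) + g p (Y p) (D X Z p))"

text \<open>
  The Levi-Civita connection is unique on smooth vector fields; the choice operator only fixes
  irrelevant values on arguments that are not smooth vector fields.
\<close>

definition levi_civita :: "('m \<Rightarrow> real) set \<Rightarrow> 'm metric \<Rightarrow> 'm connection" where
  "levi_civita F g = (SOME D. is_levi_civita F g D)"

text \<open>\<open>nabla_J F g J X Y\<close> is \<open>(D_X J) Y = D_X (J Y) - J (D_X Y)\<close>.\<close>

definition nabla_J :: "('m \<Rightarrow> real) set \<Rightarrow> 'm metric \<Rightarrow> 'm endo \<Rightarrow> 'm connection" where
  "nabla_J F g J X Y =
     levi_civita F g X (app_endo J Y) - app_endo J (levi_civita F g X Y)"

definition quasi_kaehler :: "('m \<Rightarrow> real) set \<Rightarrow> 'm metric \<Rightarrow> 'm endo \<Rightarrow> bool" where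
  "quasi_kaehler F g J \<longleftrightarrow> almost_hermitian F g J \<and>
     (\<forall>X\<in>vfields F. \<forall>Y\<in>vfields F.
        nabla_J F g J X Y + nabla_J F g J (app_endo J X) (app_endo J Y) = 0)"

definition nearly_kaehler :: "('m \<Rightarrow> real) set \<Rightarrow> 'm metric \<Rightarrow> 'm endo \<Rightarrow> bool" where
  "nearly_kaehler F g J \<longleftrightarrow> almost_hermitian F g J \<and>
     (\<forall>X\<in>vfields F. \<forall>Y\<in>vfields F. nabla_J F g J X Y = - nabla_J F g J Y X)"

definition kaehler :: "('m \<Rightarrow> real) set \<Rightarrow> 'm metric \<Rightarrow> 'm endo \<Rightarrow> bool" where
  "kaehler F g J \<longleftrightarrow> almost_hermitian F g J \<and>
     (\<forall>X\<in>vfields F. \<forall>Y\<in>vfields F. nabla_J F g J X Y = 0)"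


section \<open>Quaternions and the Hopf fibration\<close>

text \<open>
  The pair \<open>(z, w)\<close> of complex numbers stands for the quaternion \<open>z + w j\<close>, so that
  \<open>((z1, z2), (z3, z4))\<close> is at the same time a vector of \<open>C^4\<close> and the element
  \<open>(z1 + z2 j, z3 + z4 j)\<close> of \<open>H^2\<close>; its inner product and norm are the Euclidean ones of
  \<open>R^8\<close>. The product formula comes from \<open>j c = cnj c j\<close> for complex \<open>c\<close> and \<open>j^2 = - 1\<close>.
\<close>

type_synonym quat = "complex \<times> complex"
type_synonym c4 = "quat \<times> quat"

definition qmult :: "quat \<Rightarrow> quat \<Rightarrow> quat" where
  "qmult x y = (fst x * fst y - snd x * cnj (snd y), fst x * snd y + snd x * cnj (fst y))"

definition lmult :: "quat \<Rightarrow> c4 \<Rightarrow> c4" where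
  "lmult x q = (qmult x (fst q), qmult x (snd q))"

definition cmult :: "complex \<Rightarrow> c4 \<Rightarrow> c4" where
  "cmult c = lmult (c, 0)"

definition imult :: "c4 \<Rightarrow> c4" where "imult = lmult (\<i>, 0)"
definition jmult :: "c4 \<Rightarrow> c4" where "jmult = lmult (0, 1)"
definition kmult :: "c4 \<Rightarrow> c4" where "kmult = lmult (qmult (\<i>, 0) (0, 1))"

typedef cp3 = "{range (\<lambda>c. cmult c z) | z. z \<noteq> (0 :: c4)}"
  by (auto intro: exI[of _ "((1, 0), (0, 0))"] simp: zero_prod_def)

text \<open>
  \<open>hopf\<close> is defined on all nonzero vectors (and junk at \<open>0\<close>); the Hopf fibration is its
  restriction to the unit sphere.
\<close>

definition hopf :: "c4 \<Rightarrow> cp3" where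
  "hopf z = Abs_cp3 (range (\<lambda>c. cmult c z))"

text \<open>The fibres of the Hopf fibration are the orbits of the unit complex numbers.\<close>

lemma cmult_cmult: "cmult a (cmult b z) = cmult (a*b) z" and cmult_1: "cmult 1 z = z"
  by (simp_all add: cmult_def lmult_def qmult_def algebra_simps)

lemma norm_cmult: "norm (cmult c z) = cmod c * norm z"
  by (simp add: cmult_def lmult_def qmult_def norm_prod_def norm_mult power_mult_distrib flip: distrib_left real_sqrt_mult)
   (simp add: real_sqrt_mult)

lemma linear_cmult: "linear (cmult c)"
  by (rule linearI) (simp_all add: cmult_def lmult_def qmult_def prod_eq_iff algebra_simps)

lemma hopf_in: "z \<noteq> 0 \<Longrightarrow> range (\<lambda>c. cmult c z) \<in> {range (\<lambda>c. cmult c z) | z. z \<noteq> 0}" by blast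

lemma hopf_eq_iff: assumes "norm q = 1" "norm q' = 1" 
  shows "hopf q = hopf q' \<longleftrightarrow> (\<exists>c. cmod c = 1 \<and> q' = cmult c q)"
proof
  have nz: "q \<noteq> 0" "q' \<noteq> 0" using assms by auto
  assume "hopf q = hopf q'"
  then have "range (\<lambda>c. cmult c q) = range (\<lambda>c. cmult c q')"
    unfolding hopf_def using Abs_cp3_inject[OF hopf_in[OF nz(1)] hopf_in[OF nz(2)]] by simp
  moreover have "q' \<in> range (\<lambda>c. cmult c q')" by (metis cmult_1 rangeI)
  ultimately obtain c where "q' = cmult c q" by auto
  then show "\<exists>c. cmod c = 1 \<and> q' = cmult c q" using assms norm_cmult[of c q] by auto
next
  assume "\<exists>c. cmod c = 1 \<and> q' = cmult c q"
  then obtain c where c: "cmod c = 1" "q' = cmult c q" by auto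
  then have "c \<noteq> 0" by auto
  then have "range (\<lambda>a. cmult a q) = range (\<lambda>a. cmult a q')"
    unfolding c cmult_cmult by (auto simp: image_iff) (metis nonzero_eq_divide_eq)
  then show "hopf q = hopf q'" by (simp add: hopf_def)
qed

lemma hopf_cmult: assumes "c \<noteq> 0" shows "hopf (cmult c z) = hopf z"
proof -
  have "range (\<lambda>a. cmult a z) = range (\<lambda>a. cmult a (cmult c z))"
    unfolding cmult_cmult using assms
    by (auto simp only: image_iff) (metis UNIV_I nonzero_eq_divide_eq)+
  then show ?thesis by (simp add: hopf_def)
qed

lemma hopf_surj: "\<exists>q. norm q = 1 \<and> hopf q = p"
proof -
  obtain z where z: "z \<noteq> 0" "p = hopf z" unfolding hopf_def
    using Abs_cp3_cases[of p] by (smt (verit) mem_Collect_eq)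
  let ?r = "complex_of_real (1 / norm z)"
  have "cmod ?r * norm z = 1" using z(1) by (simp add: norm_divide)
  moreover have "hopf (cmult ?r z) = hopf z" using z by (intro hopf_cmult) auto
  ultimately show ?thesis using z norm_cmult by metis
qed

text \<open>The quotient smooth structure of the submersion \<open>C^4 - {0} \<rightarrow> CP^3\<close>.\<close>

definition smooth_cp3 :: "(cp3 \<Rightarrow> real) set" where
  "smooth_cp3 = {f. smooth_on (- {0}) (\<lambda>z. f (hopf z))}"

definition tangent_S7 :: "c4 \<Rightarrow> c4 set" where
  "tangent_S7 q = {q}\<^sup>\<bottom>"

text \<open>The differential at \<open>q\<close>; on \<open>tangent_S7 q\<close> it is that of the Hopf fibration.\<close>

definition dhopf :: "c4 \<Rightarrow> c4 \<Rightarrow> cp3 tvec" where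
  "dhopf q v = (\<lambda>f. if f \<in> smooth_cp3
                    then frechet_derivative (\<lambda>z. f (hopf z)) (at q) v else 0)"

lemma dhopf_cmult:
  assumes "c \<noteq> 0" "q \<noteq> 0"
  shows "dhopf (cmult c q) (cmult c v) = dhopf q v"
proof
  fix f
  show "dhopf (cmult c q) (cmult c v) f = dhopf q v f"
  proof (cases "f \<in> smooth_cp3")
    case True
    let ?h = "\<lambda>z. f (hopf z)"
    have d: "?h differentiable (at z)" if "z \<noteq> 0" for z
    proof -
      have "Ck_on (Suc 0) (-{0}) ?h" using True unfolding smooth_cp3_def smooth_on_def by blast
      then show ?thesis using that by simp
    qed
    have nz: "cmult c q \<noteq> 0" using assms norm_cmult[of c q] by (metis norm_eq_zero mult_eq_0_iff)
    have "(?h has_derivative frechet_derivative ?h (at (cmult c q))) (at (cmult c q))"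
      using d[OF nz] frechet_derivative_works by blast
    moreover have "(cmult c has_derivative cmult c) (at q)"
      using linear_cmult linear_imp_has_derivative by blast
    ultimately have "(?h \<circ> cmult c has_derivative frechet_derivative ?h (at (cmult c q)) \<circ> cmult c) (at q)"
      by (rule diff_chain_at[rotated])
    moreover have "?h \<circ> cmult c = ?h" using hopf_cmult[OF assms(1)] by auto
    ultimately have "frechet_derivative ?h (at q) = frechet_derivative ?h (at (cmult c q)) \<circ> cmult c"
      using frechet_derivative_at by force
    then show ?thesis using True by (simp add: dhopf_def)
  qed (simp add: dhopf_def)
qed

text \<open>
  A point of the Hopf fibre over \<open>p\<close>. The notions defined through it below do not depend on
  which point of the fibre is chosen: by \<open>hopf_eq_iff\<close> and \<open>dhopf_cmult\<close>, two choices differ by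
  the isometry \<open>cmult c\<close> with \<open>cmod c = 1\<close>, which commutes with \<open>imult\<close>, maps
  \<open>span {jmult q, kmult q}\<close> onto the corresponding span at \<open>cmult c q\<close>, and is compatible with
  \<open>dhopf\<close>.
\<close>

definition hopf_rep :: "cp3 \<Rightarrow> c4" where
  "hopf_rep p = (SOME q. norm q = 1 \<and> hopf q = p)"


lemma hopf_rep: "norm (hopf_rep p) = 1" "hopf (hopf_rep p) = p"
  using someI_ex[OF hopf_surj[of p]] by (auto simp: hopf_rep_def)


section \<open>The distributions, metrics and almost complex structure on \<open>CP^3\<close>\<close>

definition D1 :: "cp3 \<Rightarrow> cp3 tvec set" where
  "D1 p = (let q = hopf_rep p in dhopf q ` span {jmult q, kmult q})"

definition D2 :: "cp3 \<Rightarrow> cp3 tvec set" where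
  "D2 p = (let q = hopf_rep p in
     dhopf q ` (tangent_S7 q \<inter> (span {imult q, jmult q, kmult q})\<^sup>\<bottom>))"

definition horizontal :: "c4 \<Rightarrow> c4 set" where
  "horizontal q = tangent_S7 q \<inter> (span {imult q})\<^sup>\<bottom>"

definition hlift :: "c4 \<Rightarrow> cp3 tvec \<Rightarrow> c4" where
  "hlift q u = (THE v. v \<in> horizontal q \<and> dhopf q v = u)"

definition g1 :: "cp3 metric" where
  "g1 p u v = (let q = hopf_rep p in hlift q u \<bullet> hlift q v)"

definition J1 :: "cp3 endo" where
  "J1 p u = (let q = hopf_rep p in dhopf q (imult (hlift q u)))"

definition part1 :: "cp3 \<Rightarrow> cp3 tvec \<Rightarrow> cp3 tvec" where
  "part1 p u = (THE v. v \<in> D1 p \<and> u - v \<in> D2 p)"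

definition part2 :: "cp3 \<Rightarrow> cp3 tvec \<Rightarrow> cp3 tvec" where
  "part2 p u = u - part1 p u"

definition J_cp3 :: "cp3 endo" where
  "J_cp3 p u = - J1 p (part1 p u) + J1 p (part2 p u)"

definition g_cp3 :: "real \<Rightarrow> cp3 metric" where
  "g_cp3 a p u v = g1 p (part1 p u) (part1 p v) + a * g1 p (part2 p u) (part2 p v)"

end

theory Submission
  imports Defs
begin

text \<open>
  Vector fields on \<open>CP^3\<close> are the horizontal, \<open>C^*\<close>-equivariant vector fields on \<open>C^4 - {0}\<close>. In
  terms of such lifts \<open>\<xi>\<close>, \<open>\<eta>\<close> at a unit vector \<open>q\<close>, with \<open>\<xi>2\<close>, \<open>\<eta>2\<close> their components orthogonal to
  \<open>jq\<close>, \<open>kq\<close> and \<open>\<gamma>(y, x) = (y \<bullet> jq) jx + (y \<bullet> kq) kx\<close>, the Levi-Civita connection of \<open>g_a\<close> is the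
  horizontal part of \<open>d\<eta>(\<xi>)\<close> plus \<open>((1 - a) / a) (\<gamma>(\<eta>, \<xi>2) + \<gamma>(\<xi>, \<eta>2))\<close>. This gives
  \<open>(D_X J) Y = - 2 i (\<beta>(\<xi>, \<eta>) + \<gamma>(\<eta>, \<xi>2) / a + (1 / a - 1) \<gamma>(\<xi>, \<eta>2))\<close> with the skew form
  \<open>\<beta>(\<xi>, \<eta>) = (\<eta> \<bullet> j\<xi>) jq + (\<eta> \<bullet> k\<xi>) kq\<close>. Both \<open>\<beta>\<close> and \<open>\<gamma>\<close> change sign when \<open>J\<close> is applied to
  both fields, and the symmetrisation in \<open>X\<close>, \<open>Y\<close> is proportional to \<open>2 / a - 1\<close>.
\<close>

subsection \<open>Smooth maps\<close>

text \<open>The first distribution is tangent to the fibres of the twistor fibration of CP^3 over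
  HP^1, and \<open>g_cp3 a\<close> rescales the complementary directions. The vectors jq and kq do
  not descend to CP^3, since j(cq) is the conjugate of c times jq; only the projection onto their
  span does, so all tensors are built from that projection. Working on an open subset of C^4 instead
  of the sphere replaces charts by ordinary Frechet derivatives. As \<open>levi_civita\<close> is a
  choice, an explicit connection has to be found, verified and shown to be unique before J can be
  differentiated. Origin of the constant 2: the Fubini-Study connection alone contributes
  \<gamma>(\<eta>, \<xi>2) with coefficient 1 and no \<gamma>(\<xi>, \<eta>2), while the correction
  adds (1 - a) / a to both. The resulting coefficients 1 / a and 1 / a - 1 are opposite exactly for
  a = 2, and the first never vanishes, which excludes the Kaehler case.\<close>

lemma Ck_on_cong:
  assumes "open S" "\<And>x. x \<in> S \<Longrightarrow> f x = g x" "Ck_on k S f"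
  shows "Ck_on k S g"
  using assms(2,3)
proof (induction k arbitrary: f g)
  case 0
  then show ?case using continuous_on_cong[of S S f g] by simp
next
  case (Suc k)
  have D: "(g has_derivative frechet_derivative f (at x)) (at x)" if "x \<in> S" for x
  proof (rule has_derivative_transform_within_open[OF _ assms(1) that])
    show "(f has_derivative frechet_derivative f (at x)) (at x)"
      using Suc.prems that frechet_derivative_works[of f "at x"] by simp
  qed (rule Suc.prems)
  have E: "frechet_derivative g (at x) = frechet_derivative f (at x)" if "x \<in> S" for x
    using frechet_derivative_at[OF D[OF that]] by simp
  have "Ck_on k S (\<lambda>x. frechet_derivative g (at x) v)" for v
    by (rule Suc.IH[of "\<lambda>x. frechet_derivative f (at x) v"]) (use Suc.prems E in auto)
  moreover have "\<forall>x\<in>S. g differentiable (at x)" using D differentiableI by blast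
  ultimately show ?case unfolding Ck_on.simps(2) by blast
qed

text \<open>\<open>Ck_on (Suc k)\<close> only speaks of derivatives, whereas product and quotient
  rules combine a function and its derivative at the same order k.\<close>

lemma Ck_on_lower: "Ck_on (Suc k) S f \<Longrightarrow> Ck_on k S f"
proof (induction k arbitrary: f)
  case 0
  then have "isCont f x" if "x \<in> S" for x
    using that differentiable_imp_continuous_within[of f x UNIV] by simp
  then show ?case by (simp add: continuous_at_imp_continuous_on)
next
  case (Suc k)
  have "Ck_on (Suc k) S (\<lambda>x. frechet_derivative f (at x) v)" for v
    using Suc.prems unfolding Ck_on.simps(2)[of "Suc k"] by blast
  note Suc.IH[OF this]
  moreover have "\<forall>x\<in>S. f differentiable (at x)"
    using Suc.prems unfolding Ck_on.simps(2) by blast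
  ultimately show ?case unfolding Ck_on.simps(2) by blast
qed

text \<open>Lets the closure rules below exhibit a concrete derivative and leaves the identification
  with \<open>frechet_derivative\<close> to uniqueness.\<close>

lemma Ck_on_SucI:
  assumes "open S" "\<And>x. x \<in> S \<Longrightarrow> (f has_derivative f' x) (at x)"
    "\<And>v. Ck_on k S (\<lambda>x. f' x v)"
  shows "Ck_on (Suc k) S f"
proof -
  have "f' x = frechet_derivative f (at x)" if "x \<in> S" for x
    using frechet_derivative_at[OF assms(2)[OF that]] .
  then have "Ck_on k S (\<lambda>x. frechet_derivative f (at x) v)" for v
    using Ck_on_cong[OF assms(1) _ assms(3)[of v]] by simp
  moreover have "f differentiable (at x)" if "x \<in> S" for x
    using assms(2)[OF that] by (rule differentiableI)
  ultimately show ?thesis unfolding Ck_on.simps by blast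
qed

lemma Ck_on_has_derivative:
  "Ck_on (Suc k) S f \<Longrightarrow> x \<in> S \<Longrightarrow> (f has_derivative frechet_derivative f (at x)) (at x)"
  unfolding Ck_on.simps using frechet_derivative_works[of f "at x"] by blast

lemma Ck_on_const: "open S \<Longrightarrow> Ck_on k S (\<lambda>x. c)"
proof (induction k arbitrary: c)
  case (Suc k)
  then show ?case by (auto intro!: Ck_on_SucI[where f' = "\<lambda>x v. 0"])
qed simp

lemma Ck_on_add:
  assumes "open S"
  shows "Ck_on k S f \<Longrightarrow> Ck_on k S g \<Longrightarrow> Ck_on k S (\<lambda>x. f x + g x)"
proof (induction k arbitrary: f g)
  case (Suc k)
  show ?case
  proof (rule Ck_on_SucI[OF assms has_derivative_add[OF Suc.prems[THEN Ck_on_has_derivative]]])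
    show "Ck_on k S (\<lambda>x. frechet_derivative f (at x) v + frechet_derivative g (at x) v)" for v
      by (rule Suc.IH) (use Suc.prems in simp_all)
  qed
qed (simp add: continuous_on_add)

lemma Ck_on_bounded_linear:
  assumes "open S" "bounded_linear L"
  shows "Ck_on k S f \<Longrightarrow> Ck_on k S (\<lambda>x. L (f x))"
proof (induction k arbitrary: f)
  case 0
  then show ?case using bounded_linear.continuous_on[OF assms(2)] by auto
next
  case (Suc k)
  show ?case
  proof (rule Ck_on_SucI[OF assms(1) bounded_linear.has_derivative[OF assms(2) Ck_on_has_derivative[OF Suc.prems]]])
    show "Ck_on k S (\<lambda>x. L (frechet_derivative f (at x) v))" for v
      by (rule Suc.IH) (use Suc.prems in simp_all)
  qed
qed

lemma Ck_on_bilinear: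
  assumes "open S" "bounded_bilinear B"
  shows "Ck_on k S f \<Longrightarrow> Ck_on k S g \<Longrightarrow> Ck_on k S (\<lambda>x. B (f x) (g x))"
proof (induction k arbitrary: f g)
  case 0
  then show ?case using bounded_bilinear.continuous_on[OF assms(2)] by auto
next
  case (Suc k)
  show ?case
  proof (rule Ck_on_SucI[OF assms(1) bounded_bilinear.FDERIV[OF assms(2) Suc.prems[THEN Ck_on_has_derivative]]])
    have "Ck_on k S (\<lambda>x. B (f x) (frechet_derivative g (at x) v))"
      "Ck_on k S (\<lambda>x. B (frechet_derivative f (at x) v) (g x))" for v
      by (rule Suc.IH; use Suc.prems Ck_on_lower[OF Suc.prems(1)] Ck_on_lower[OF Suc.prems(2)] in simp)+
    then show "Ck_on k S (\<lambda>x. B (f x) (frechet_derivative g (at x) v)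
          + B (frechet_derivative f (at x) v) (g x))" for v
      by (rule Ck_on_add[OF assms(1)])
  qed
qed

text \<open>The derivative of 1/f contains 1/f itself, but only to order k, which the induction
  hypothesis supplies.\<close>

lemma Ck_on_inverse:
  fixes f :: "'a::euclidean_space \<Rightarrow> real"
  assumes "open S" "\<And>x. x \<in> S \<Longrightarrow> f x \<noteq> 0"
  shows "Ck_on k S f \<Longrightarrow> Ck_on k S (\<lambda>x. inverse (f x))"
proof (induction k)
  case 0
  then show ?case using assms(2) by (auto intro!: continuous_on_inverse)
next
  case (Suc k)
  have IH: "Ck_on k S (\<lambda>x. inverse (f x))" using Suc Ck_on_lower by blast
  note mult = Ck_on_bilinear[OF assms(1) bounded_bilinear_mult]
  have "Ck_on k S (\<lambda>x. - (inverse (f x) * frechet_derivative f (at x) v * inverse (f x)))" for v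
    using Suc.prems IH
    by (intro Ck_on_bounded_linear[OF assms(1) bounded_linear_minus[OF bounded_linear_ident]] mult) auto
  then show ?case
    by (rule Ck_on_SucI[OF assms(1) Deriv.has_derivative_inverse[OF assms(2) Ck_on_has_derivative[OF Suc.prems]], rotated -1])
qed

text \<open>The chain rule for straight lines, which serve as the curves representing horizontal
  tangent vectors.\<close>

lemma Ck_on_affine_line:
  assumes "open S" "\<And>t. q + t *\<^sub>R v \<in> S"
  shows "Ck_on k S f \<Longrightarrow> Ck_on k UNIV (\<lambda>t. f (q + t *\<^sub>R v))"
proof (induction k arbitrary: f)
  case 0
  then show ?case using assms
    by (auto intro!: continuous_on_compose2[where f = "\<lambda>t. q + t *\<^sub>R v"] continuous_intros)
next
  case (Suc k)
  let ?d = "\<lambda>x. frechet_derivative f (at x)"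
  have "((\<lambda>t. f (q + t *\<^sub>R v)) has_derivative (\<lambda>r. r *\<^sub>R ?d (q + t *\<^sub>R v) v)) (at t)" for t
  proof -
    have f: "(f has_derivative ?d (q + t *\<^sub>R v)) (at (q + t *\<^sub>R v))"
      using Ck_on_has_derivative[OF Suc.prems assms(2)] .
    have "((\<lambda>t. q + t *\<^sub>R v) has_derivative (\<lambda>r. r *\<^sub>R v)) (at t)"
      by (auto intro!: derivative_eq_intros)
    from diff_chain_at[OF this f] show ?thesis
      using linear_cmul[OF has_derivative_linear[OF f]] by (simp add: o_def)
  qed
  moreover have "Ck_on k UNIV (\<lambda>t. r *\<^sub>R ?d (q + t *\<^sub>R v) v)" for r
    using Suc by (auto intro!: Ck_on_bounded_linear[OF open_UNIV bounded_linear_scaleR_right])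
  ultimately show ?case by (rule Ck_on_SucI[OF open_UNIV])
qed

lemma smooth_on_has_derivative:
  "smooth_on S f \<Longrightarrow> x \<in> S \<Longrightarrow> (f has_derivative frechet_derivative f (at x)) (at x)"
  unfolding smooth_on_def using Ck_on_has_derivative by blast

lemma smooth_on_cong:
  "open S \<Longrightarrow> (\<And>x. x \<in> S \<Longrightarrow> f x = g x) \<Longrightarrow> smooth_on S f \<longleftrightarrow> smooth_on S g"
  unfolding smooth_on_def by (metis Ck_on_cong)

lemma smooth_on_const: "open S \<Longrightarrow> smooth_on S (\<lambda>x. c)"
  by (simp add: smooth_on_def Ck_on_const)

lemma smooth_on_ident: "open S \<Longrightarrow> smooth_on S (\<lambda>x. x)"
  unfolding smooth_on_def
proof
  fix k :: nat assume "open S"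
  then show "Ck_on k S (\<lambda>x. x)"
    by (cases k) (auto intro!: Ck_on_SucI[where f' = "\<lambda>x v. v"] Ck_on_const simp del: Ck_on.simps(2))
qed

lemma smooth_on_add: "open S \<Longrightarrow> smooth_on S f \<Longrightarrow> smooth_on S g \<Longrightarrow> smooth_on S (\<lambda>x. f x + g x)"
  by (simp add: smooth_on_def Ck_on_add)

lemma smooth_on_bounded_linear:
  "bounded_linear L \<Longrightarrow> open S \<Longrightarrow> smooth_on S f \<Longrightarrow> smooth_on S (\<lambda>x. L (f x))"
  by (simp add: smooth_on_def Ck_on_bounded_linear)

lemma smooth_on_diff: "open S \<Longrightarrow> smooth_on S f \<Longrightarrow> smooth_on S g \<Longrightarrow> smooth_on S (\<lambda>x. f x - g x)"
  using smooth_on_add[of S f "\<lambda>x. - g x"]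
    smooth_on_bounded_linear[OF bounded_linear_minus[OF bounded_linear_ident], of S g] by simp

lemma smooth_on_scaleR:
  "open S \<Longrightarrow> smooth_on S f \<Longrightarrow> smooth_on S g \<Longrightarrow> smooth_on S (\<lambda>x. f x *\<^sub>R g x)"
  by (simp add: smooth_on_def Ck_on_bilinear[OF _ bounded_bilinear_scaleR])

lemma smooth_on_mult:
  fixes f g :: "'a::euclidean_space \<Rightarrow> real"
  shows "open S \<Longrightarrow> smooth_on S f \<Longrightarrow> smooth_on S g \<Longrightarrow> smooth_on S (\<lambda>x. f x * g x)"
  by (simp add: smooth_on_def Ck_on_bilinear[OF _ bounded_bilinear_mult])

lemma smooth_on_inner:
  "open S \<Longrightarrow> smooth_on S f \<Longrightarrow> smooth_on S g \<Longrightarrow> smooth_on S (\<lambda>x. f x \<bullet> g x)"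
  by (simp add: smooth_on_def Ck_on_bilinear[OF _ bounded_bilinear_inner])

lemma smooth_on_divide:
  fixes f g :: "'a::euclidean_space \<Rightarrow> real"
  assumes "open S" "smooth_on S f" "smooth_on S g" "\<And>x. x \<in> S \<Longrightarrow> g x \<noteq> 0"
  shows "smooth_on S (\<lambda>x. f x / g x)"
proof -
  have "smooth_on S (\<lambda>x. inverse (g x))"
    using assms by (simp add: smooth_on_def Ck_on_inverse)
  then show ?thesis using smooth_on_mult[OF assms(1,2)] by (simp add: divide_inverse)
qed

lemma smooth_on_sum:
  "open S \<Longrightarrow> (\<And>i. i \<in> A \<Longrightarrow> smooth_on S (f i)) \<Longrightarrow> smooth_on S (\<lambda>x. \<Sum>i\<in>A. f i x)"
  by (induction A rule: infinite_finite_induct) (auto intro: smooth_on_const smooth_on_add)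

lemma smooth_on_frechet_derivative_const:
  "smooth_on S f \<Longrightarrow> smooth_on S (\<lambda>x. frechet_derivative f (at x) v)"
  unfolding smooth_on_def
proof
  fix k assume "\<forall>k. Ck_on k S f"
  then have "Ck_on (Suc k) S f" by blast
  then show "Ck_on k S (\<lambda>x. frechet_derivative f (at x) v)" by simp
qed

text \<open>\<open>smooth_on\<close> controls derivatives in fixed directions only; a variable
  direction is expanded in the standard basis.\<close>

lemma smooth_on_frechet_derivative:
  fixes f :: "'a::euclidean_space \<Rightarrow> 'b::real_normed_vector"
  assumes "open S" "smooth_on S f" "smooth_on S \<xi>"
  shows "smooth_on S (\<lambda>x. frechet_derivative f (at x) (\<xi> x))"
proof -
  have eq: "frechet_derivative f (at x) (\<xi> x) =
      (\<Sum>b\<in>Basis. (\<xi> x \<bullet> b) *\<^sub>R frechet_derivative f (at x) b)" if "x \<in> S" for x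
  proof -
    have lin: "linear (frechet_derivative f (at x))"
      using smooth_on_has_derivative[OF assms(2) that] has_derivative_linear by blast
    show ?thesis
      using linear_sum[OF lin, of "\<lambda>b. (\<xi> x \<bullet> b) *\<^sub>R b" Basis]
      by (simp add: linear_cmul[OF lin] euclidean_representation)
  qed
  have "smooth_on S (\<lambda>x. \<Sum>b\<in>Basis. (\<xi> x \<bullet> b) *\<^sub>R frechet_derivative f (at x) b)"
    by (intro smooth_on_sum smooth_on_scaleR smooth_on_inner smooth_on_const
        smooth_on_frechet_derivative_const assms)
  then show ?thesis using smooth_on_cong[OF assms(1) eq] by simp
qed

section \<open>Symmetry of second derivatives\<close>

text \<open>Two applications of the mean value theorem turn the second difference into h^2 times the
  mixed derivative at a nearby point, and continuity of that derivative at x bounds the error. The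
  second difference is symmetric in v and w, which yields the symmetry below.\<close>

lemma second_difference_bound:
  fixes f :: "'a::euclidean_space \<Rightarrow> real"
  assumes S: "open S" "x \<in> S" and f: "smooth_on S f" and e: "0 < e"
  shows "\<exists>d>0. \<forall>h. 0 < h \<longrightarrow> h < d \<longrightarrow>
    \<bar>f (x + h *\<^sub>R v + h *\<^sub>R w) - f (x + h *\<^sub>R v) - f (x + h *\<^sub>R w) + f x
      - h * h * frechet_derivative (\<lambda>y. frechet_derivative f (at y) v) (at x) w\<bar> \<le> e * (h * h)"
proof -
  define f1 where "f1 = (\<lambda>y. frechet_derivative f (at y) v)"
  define f2 where "f2 = (\<lambda>y. frechet_derivative f1 (at y) w)"
  have sf1: "smooth_on S f1" unfolding f1_def using f by (rule smooth_on_frechet_derivative_const)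
  then have "smooth_on S f2" unfolding f2_def by (rule smooth_on_frechet_derivative_const)
  then have "isCont f2 x"
    using smooth_on_has_derivative S(2) has_derivative_continuous by blast
  then obtain d1 where d1: "d1 > 0" "\<And>y. dist y x < d1 \<Longrightarrow> dist (f2 y) (f2 x) < e"
    using e unfolding continuous_at_eps_delta by blast
  obtain d2 where d2: "d2 > 0" "\<And>y. dist y x < d2 \<Longrightarrow> y \<in> S"
    using S open_dist by metis
  \<comment> \<open>Chosen so that the whole parallelogram spanned by h v and h w stays within
    \<open>min d1 d2\<close> of x; the summand 1 keeps the denominator positive.\<close>
  define d where "d = min d1 d2 / (norm v + norm w + 1)"
  have pos: "norm v + norm w + 1 > 0" by (smt (verit) norm_ge_zero)
  then have "d > 0" using d1(1) d2(1) by (simp add: d_def)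
  have near: "dist (x + s *\<^sub>R v + t *\<^sub>R w) x < min d1 d2"
    if "0 \<le> s" "s \<le> h" "0 \<le> t" "t \<le> h" "h < d" for s t h
  proof -
    have "dist (x + s *\<^sub>R v + t *\<^sub>R w) x = norm (s *\<^sub>R v + t *\<^sub>R w)" by (simp add: dist_norm)
    also have "\<dots> \<le> s * norm v + t * norm w" using that norm_triangle_ineq[of "s *\<^sub>R v" "t *\<^sub>R w"] by simp
    also have "\<dots> \<le> h * norm v + h * norm w" using that by (intro add_mono mult_right_mono) auto
    also have "\<dots> \<le> h * (norm v + norm w + 1)" using that by (simp add: algebra_simps)
    also have "\<dots> < d * (norm v + norm w + 1)" using that pos by simp
    also have "\<dots> = min d1 d2" using pos by (simp add: d_def)
    finally show ?thesis .
  qed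
  have line: "((\<lambda>t. u (y + t *\<^sub>R z)) has_real_derivative frechet_derivative u (at (y + t *\<^sub>R z)) z) (at t)"
    if "smooth_on S u" "y + t *\<^sub>R z \<in> S" for u :: "'a \<Rightarrow> real" and y z t
  proof -
    have D: "(u has_derivative frechet_derivative u (at (y + t *\<^sub>R z))) (at (y + t *\<^sub>R z))"
      using smooth_on_has_derivative that by blast
    have "((\<lambda>t. y + t *\<^sub>R z) has_derivative (\<lambda>r. r *\<^sub>R z)) (at t)"
      by (auto intro!: derivative_eq_intros)
    from diff_chain_at[OF this D] show ?thesis
      using linear_cmul[OF has_derivative_linear[OF D]]
      by (simp add: o_def has_field_derivative_def mult_commute_abs)
  qed
  show ?thesis
  proof (intro exI[of _ d] conjI allI impI \<open>d > 0\<close>)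
    fix h :: real assume h: "0 < h" "h < d"
    have inS: "x + s *\<^sub>R v + t *\<^sub>R w \<in> S" if "0 \<le> s" "s \<le> h" "0 \<le> t" "t \<le> h" for s t
      using near[OF that h(2)] d2(2) by simp
    \<comment> \<open>Mean value theorem for the increment in direction w, regarded as a function of
      the displacement in direction v.\<close>
    have "\<exists>s. 0 < s \<and> s < h \<and> (f (x + h *\<^sub>R w + h *\<^sub>R v) - f (x + h *\<^sub>R v)) - (f (x + h *\<^sub>R w + 0 *\<^sub>R v) - f (x + 0 *\<^sub>R v))
       = (h - 0) * (f1 (x + h *\<^sub>R w + s *\<^sub>R v) - f1 (x + s *\<^sub>R v))"
    proof (rule MVT2[OF h(1)])
      fix s :: real assume s: "0 \<le> s" "s \<le> h"
      show "((\<lambda>s. f (x + h *\<^sub>R w + s *\<^sub>R v) - f (x + s *\<^sub>R v)) has_real_derivative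
          f1 (x + h *\<^sub>R w + s *\<^sub>R v) - f1 (x + s *\<^sub>R v)) (at s)"
        unfolding f1_def by (intro DERIV_diff line f)
          (use inS[OF s, of h] inS[OF s, of 0] h in \<open>simp_all add: add.commute add.left_commute\<close>)
    qed
    then obtain s where s: "0 < s" "s < h"
      "f (x + h *\<^sub>R v + h *\<^sub>R w) - f (x + h *\<^sub>R v) - f (x + h *\<^sub>R w) + f x
        = h * (f1 (x + s *\<^sub>R v + h *\<^sub>R w) - f1 (x + s *\<^sub>R v))"
      by (auto simp: algebra_simps)
    have "\<exists>t. 0 < t \<and> t < h \<and> f1 (x + s *\<^sub>R v + h *\<^sub>R w) - f1 (x + s *\<^sub>R v + 0 *\<^sub>R w)
      = (h - 0) * f2 (x + s *\<^sub>R v + t *\<^sub>R w)"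
      unfolding f2_def by (rule MVT2[OF h(1)]) (use inS[of s] s line[OF sf1] in auto)
    then obtain t where t: "0 < t" "t < h"
      "f1 (x + s *\<^sub>R v + h *\<^sub>R w) - f1 (x + s *\<^sub>R v) = h * f2 (x + s *\<^sub>R v + t *\<^sub>R w)"
      by auto
    have "\<bar>f2 (x + s *\<^sub>R v + t *\<^sub>R w) - f2 x\<bar> < e"
      using d1(2) near[of s h t] s t h(2) by (simp add: dist_real_def)
    then have "\<bar>h * h * (f2 (x + s *\<^sub>R v + t *\<^sub>R w) - f2 x)\<bar> \<le> h * h * e"
      unfolding abs_mult using h(1) by (intro mult_mono) auto
    then show "\<bar>f (x + h *\<^sub>R v + h *\<^sub>R w) - f (x + h *\<^sub>R v) - f (x + h *\<^sub>R w) + f x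
        - h * h * frechet_derivative (\<lambda>y. frechet_derivative f (at y) v) (at x) w\<bar> \<le> e * (h * h)"
      unfolding s(3) t(3) f1_def[symmetric] by (simp add: f2_def algebra_simps)
  qed
qed

lemma frechet_derivative_commute:
  fixes f :: "'a::euclidean_space \<Rightarrow> real"
  assumes "open S" "x \<in> S" "smooth_on S f"
  shows "frechet_derivative (\<lambda>y. frechet_derivative f (at y) v) (at x) w
       = frechet_derivative (\<lambda>y. frechet_derivative f (at y) w) (at x) v" (is "?A = ?B")
proof (rule ccontr)
  assume "?A \<noteq> ?B"
  \<comment> \<open>Both mixed derivatives lie within e of the same difference quotient, hence
    within 2 e of each other, while their distance is 3 e.\<close>
  define e where "e = \<bar>?A - ?B\<bar> / 3"
  have e: "e > 0" using \<open>?A \<noteq> ?B\<close> by (simp add: e_def)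
  obtain d1 d2 where d: "d1 > 0" "d2 > 0"
    and 1: "\<And>h. 0 < h \<Longrightarrow> h < d1 \<Longrightarrow> \<bar>f (x + h *\<^sub>R v + h *\<^sub>R w) - f (x + h *\<^sub>R v) - f (x + h *\<^sub>R w) + f x
      - h * h * ?A\<bar> \<le> e * (h * h)"
    and 2: "\<And>h. 0 < h \<Longrightarrow> h < d2 \<Longrightarrow> \<bar>f (x + h *\<^sub>R w + h *\<^sub>R v) - f (x + h *\<^sub>R w) - f (x + h *\<^sub>R v) + f x
      - h * h * ?B\<bar> \<le> e * (h * h)"
    using second_difference_bound[OF assms e] by metis
  define h where "h = min d1 d2 / 2"
  have h: "0 < h" "h < d1" "h < d2" using d by (auto simp: h_def)
  have "x + h *\<^sub>R w + h *\<^sub>R v = x + h *\<^sub>R v + h *\<^sub>R w" by simp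
  then have "\<bar>h * h * ?A - h * h * ?B\<bar> \<le> 2 * e * (h * h)"
    using 1[OF h(1,2)] 2[OF h(1,3)] unfolding \<open>x + h *\<^sub>R w + h *\<^sub>R v = _\<close> by linarith
  then have "h * h * \<bar>?A - ?B\<bar> \<le> h * h * (2 * e)"
    using h(1) by (simp add: abs_mult ac_simps flip: right_diff_distrib)
  then have "\<bar>?A - ?B\<bar> \<le> 2 * e" using h(1) by simp
  then show False using e by (simp add: e_def)
qed

subsection \<open>Quaternionic linear algebra\<close>

lemma linear_imult: "linear imult" and linear_jmult: "linear jmult" and linear_kmult: "linear kmult"
  by (rule linearI; simp add: imult_def jmult_def kmult_def lmult_def qmult_def prod_eq_iff algebra_simps)+

lemmas bounded_linear_imult = linear_conv_bounded_linear[THEN iffD1, OF linear_imult]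
  and bounded_linear_jmult = linear_conv_bounded_linear[THEN iffD1, OF linear_jmult]
  and bounded_linear_kmult = linear_conv_bounded_linear[THEN iffD1, OF linear_kmult]

lemmas ijk_linear [simp] =
  linear_add[OF linear_imult] linear_add[OF linear_jmult] linear_add[OF linear_kmult]
  linear_diff[OF linear_imult] linear_diff[OF linear_jmult] linear_diff[OF linear_kmult]
  linear_neg[OF linear_imult] linear_neg[OF linear_jmult] linear_neg[OF linear_kmult]
  linear_0[OF linear_imult] linear_0[OF linear_jmult] linear_0[OF linear_kmult]
  linear_cmul[OF linear_imult] linear_cmul[OF linear_jmult] linear_cmul[OF linear_kmult]

lemma ijk_mult [simp]:
  "imult (imult v) = - v" "imult (jmult v) = kmult v" "imult (kmult v) = - jmult v"
  "jmult (imult v) = - kmult v" "jmult (jmult v) = - v" "jmult (kmult v) = imult v"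
  "kmult (imult v) = jmult v" "kmult (jmult v) = - imult v" "kmult (kmult v) = - v"
  by (simp_all add: imult_def jmult_def kmult_def lmult_def qmult_def prod_eq_iff)

lemma ijk_skew:
  "imult u \<bullet> v = - (u \<bullet> imult v)" "jmult u \<bullet> v = - (u \<bullet> jmult v)" "kmult u \<bullet> v = - (u \<bullet> kmult v)"
  by (simp_all add: imult_def jmult_def kmult_def lmult_def qmult_def inner_prod_def inner_complex_def algebra_simps)

lemma imult_inner_imult: "imult u \<bullet> imult v = u \<bullet> v"
  by (simp add: ijk_skew)

lemma ijk_swap:
  "u \<bullet> imult v = - (v \<bullet> imult u)" "u \<bullet> jmult v = - (v \<bullet> jmult u)" "u \<bullet> kmult v = - (v \<bullet> kmult u)"
  using ijk_skew[of v u] by (simp_all add: inner_commute)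

lemma ijk_inner_self [simp]: "v \<bullet> imult v = 0" "v \<bullet> jmult v = 0" "v \<bullet> kmult v = 0"
  using ijk_swap[of v v] by simp_all

lemma cmult_eq: "cmult c v = Re c *\<^sub>R v + Im c *\<^sub>R imult v"
  by (simp add: cmult_def imult_def lmult_def qmult_def prod_eq_iff complex_eq_iff)

lemma bounded_linear_cmult: "bounded_linear (cmult c)"
  using linear_conv_bounded_linear linear_cmult by blast

lemma cmult_eq_0_iff [simp]: "cmult c v = 0 \<longleftrightarrow> c = 0 \<or> v = 0"
  by (metis norm_cmult norm_eq_zero mult_eq_0_iff)

lemma cmult_inner_cmult: "cmult c u \<bullet> cmult c v = (cmod c)\<^sup>2 * (u \<bullet> v)"
  unfolding cmod_power2 by (simp add: cmult_eq inner_simps ijk_skew algebra_simps power2_eq_square)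

lemma cmult_imult: "cmult c (imult v) = imult (cmult c v)"
  by (simp add: cmult_eq)

lemma cmult_linear [simp]:
  "cmult c (u + v) = cmult c u + cmult c v" "cmult c (u - v) = cmult c u - cmult c v"
  "cmult c (- v) = - cmult c v" "cmult c (r *\<^sub>R v) = r *\<^sub>R cmult c v"
  using linear_add[OF linear_cmult] linear_diff[OF linear_cmult] linear_neg[OF linear_cmult]
    linear_cmul[OF linear_cmult] by auto

lemma horizontal_iff: "v \<in> horizontal q \<longleftrightarrow> v \<bullet> q = 0 \<and> v \<bullet> imult q = 0"
proof -
  have "(\<forall>y\<in>span {imult q}. y \<bullet> v = 0) \<longleftrightarrow> v \<bullet> imult q = 0"
    by (auto simp: span_singleton inner_commute[of v])
  then show ?thesis
    by (auto simp: horizontal_def tangent_S7_def orthogonal_comp_def orthogonal_def inner_commute)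
qed

text \<open>
  Horizontal lifts at \<open>z\<close> of the tensors on \<open>CP^3\<close>, scaled so as to be equivariant under \<open>z \<mapsto> c z\<close>
  for all complex \<open>c \<noteq> 0\<close>, not only for unit ones: \<open>vproj\<close> is the projection to the first
  distribution, and its Fubini-Study derivative along \<open>v\<close> sends \<open>e\<close> to
  \<open>bet z v e + gam z e (v - vproj z v)\<close>. In \<open>conn_lift\<close>, \<open>w\<close> stands for the derivative of the lift
  of the second field along the first one; the correction term to the Fubini-Study connection
  \<open>hproj z w\<close> is read off from the Koszul formula.
\<close>

definition hproj :: "c4 \<Rightarrow> c4 \<Rightarrow> c4" where
  "hproj z v = v - (v \<bullet> z / (z \<bullet> z)) *\<^sub>R z - (v \<bullet> imult z / (z \<bullet> z)) *\<^sub>R imult z"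

text \<open>If \<open>vproj z y\<close> is h z with h a real combination of the quaternions j and k,
  then this is h x: with p, r the inner products of y with jz, kz, it is the complex multiple (p + i
  r) / |z|^2 of jx.\<close>

definition gam :: "c4 \<Rightarrow> c4 \<Rightarrow> c4 \<Rightarrow> c4" where
  "gam z y x = (y \<bullet> jmult z / (z \<bullet> z)) *\<^sub>R jmult x + (y \<bullet> kmult z / (z \<bullet> z)) *\<^sub>R kmult x"

definition vproj :: "c4 \<Rightarrow> c4 \<Rightarrow> c4" where
  "vproj z v = gam z v z"

text \<open>The two inner products are the real and imaginary parts of the complex symplectic form
  of C^4 = H^2; so this is that form, with values in the first distribution. It is complex bilinear
  and skew.\<close>

definition bet :: "c4 \<Rightarrow> c4 \<Rightarrow> c4 \<Rightarrow> c4" where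
  "bet z x y = (y \<bullet> jmult x / (z \<bullet> z)) *\<^sub>R jmult z + (y \<bullet> kmult x / (z \<bullet> z)) *\<^sub>R kmult z"

definition J_lift :: "c4 \<Rightarrow> c4 \<Rightarrow> c4" where
  "J_lift z v = imult (v - 2 *\<^sub>R vproj z v)"

text \<open>As \<open>vproj z\<close> is a symmetric idempotent, one projection suffices to give
  weight 1 to the first distribution and a to the second. Division by |z|^2 makes the value
  invariant under simultaneous scaling of z, v and w by a nonzero complex number.\<close>

definition g_lift :: "real \<Rightarrow> c4 \<Rightarrow> c4 \<Rightarrow> c4 \<Rightarrow> real" where
  "g_lift a z v w = (a * (v \<bullet> w) + (1 - a) * (v \<bullet> vproj z w)) / (z \<bullet> z)"

definition conn_lift :: "real \<Rightarrow> c4 \<Rightarrow> c4 \<Rightarrow> c4 \<Rightarrow> c4 \<Rightarrow> c4" where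
  "conn_lift a z v e w = hproj z w + ((1 - a) / a) *\<^sub>R (gam z e (v - vproj z v) + gam z v (e - vproj z e))"

definition nabla_J_lift :: "real \<Rightarrow> c4 \<Rightarrow> c4 \<Rightarrow> c4 \<Rightarrow> c4" where
  "nabla_J_lift a z v e =
     - 2 *\<^sub>R imult (bet z v e + (1 / a) *\<^sub>R gam z e (v - vproj z v) + (1 / a - 1) *\<^sub>R gam z v (e - vproj z e))"

lemma gam_linear:
  "gam z (u + v) x = gam z u x + gam z v x" "gam z (u - v) x = gam z u x - gam z v x"
  "gam z (- v) x = - gam z v x"
  "gam z (r *\<^sub>R v) x = r *\<^sub>R gam z v x"
  "gam z v (x + y) = gam z v x + gam z v y" "gam z v (x - y) = gam z v x - gam z v y"
  "gam z v (- x) = - gam z v x"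
  "gam z v (r *\<^sub>R x) = r *\<^sub>R gam z v x"
  by (simp_all add: gam_def inner_simps scaleR_add_right scaleR_diff_right add_divide_distrib diff_divide_distrib
      scaleR_add_left scaleR_diff_left mult.commute)

lemma vproj_linear:
  "vproj z (u + v) = vproj z u + vproj z v" "vproj z (u - v) = vproj z u - vproj z v"
  "vproj z (- v) = - vproj z v"
  "vproj z (r *\<^sub>R v) = r *\<^sub>R vproj z v"
  by (simp_all add: vproj_def gam_linear)

lemma hproj_self: "hproj z z = 0" "hproj z (imult z) = 0"
  by (cases "z = 0"; simp add: hproj_def inner_commute[of "imult z" z] imult_inner_imult)+

lemma hproj_linear:
  "hproj z (u + v) = hproj z u + hproj z v" "hproj z (u - v) = hproj z u - hproj z v"
  "hproj z (- v) = - hproj z v"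
  "hproj z (r *\<^sub>R v) = r *\<^sub>R hproj z v"
  by (simp_all add: hproj_def inner_simps scaleR_diff_right add_divide_distrib diff_divide_distrib
      scaleR_add_left scaleR_diff_left)

text \<open>Complex linear in y, because replacing y by iy multiplies p + i r by i; conjugate linear
  in x, because j and k anticommute with i. These signs drive the behaviour under J.\<close>

lemma gam_imult: "gam z (imult y) x = imult (gam z y x)" "gam z y (imult x) = - imult (gam z y x)"
  by (simp_all add: gam_def ijk_skew)

lemma vproj_imult: "vproj z (imult v) = imult (vproj z v)"
  by (simp add: vproj_def gam_imult)

lemma hproj_imult: "hproj z (imult v) = imult (hproj z v)"
  by (simp add: hproj_def ijk_skew)

lemma inner_vproj: "u \<bullet> vproj z v = ((u \<bullet> jmult z) * (v \<bullet> jmult z) + (u \<bullet> kmult z) * (v \<bullet> kmult z)) / (z \<bullet> z)"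
  by (simp add: vproj_def gam_def inner_simps add_divide_distrib mult.commute)

lemma vproj_symmetric: "vproj z u \<bullet> v = u \<bullet> vproj z v"
  by (simp add: inner_vproj inner_commute[of "vproj z u"] mult.commute)

lemma vproj_inner_jk:
  assumes "z \<noteq> 0"
  shows "vproj z v \<bullet> jmult z = v \<bullet> jmult z" "vproj z v \<bullet> kmult z = v \<bullet> kmult z"
    "vproj z v \<bullet> z = 0" "vproj z v \<bullet> imult z = 0"
  using assms by (simp_all add: vproj_def gam_def inner_simps ijk_skew)

lemma vproj_vproj: "z \<noteq> 0 \<Longrightarrow> vproj z (vproj z v) = vproj z v"
  by (subst (1 3) vproj_def) (simp add: gam_def vproj_inner_jk)

lemma vproj_compl_inner_jk:
  assumes "z \<noteq> 0"
  shows "(v - vproj z v) \<bullet> jmult z = 0" "(v - vproj z v) \<bullet> kmult z = 0"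
  using assms by (simp_all add: inner_diff_left vproj_inner_jk)

lemma vproj_horizontal: "z \<noteq> 0 \<Longrightarrow> vproj z v \<in> horizontal z"
  by (simp add: horizontal_iff vproj_inner_jk)

lemma subspace_horizontal: "subspace (horizontal z)"
  by (simp add: subspace_def horizontal_iff inner_simps)

lemmas horizontal_add = subspace_add[OF subspace_horizontal]
  and horizontal_diff = subspace_diff[OF subspace_horizontal]
  and horizontal_scaleR = subspace_scale[OF subspace_horizontal]
  and horizontal_0 = subspace_0[OF subspace_horizontal]

lemma imult_horizontal: "v \<in> horizontal z \<Longrightarrow> imult v \<in> horizontal z"
  by (simp add: horizontal_iff ijk_skew)

lemma hproj_horizontal: "z \<noteq> 0 \<Longrightarrow> hproj z v \<in> horizontal z"
  by (simp add: horizontal_iff hproj_def inner_simps ijk_skew)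

lemma hproj_id: "v \<in> horizontal z \<Longrightarrow> hproj z v = v"
  by (simp add: horizontal_iff hproj_def)

lemma hproj_vproj: "z \<noteq> 0 \<Longrightarrow> hproj z (vproj z v) = vproj z v"
  by (simp add: hproj_id vproj_horizontal)

lemma vproj_hproj: "vproj z (hproj z v) = vproj z v"
  by (simp add: vproj_def gam_def hproj_def inner_simps ijk_skew)

text \<open>The complement of the quaternionic line through z is stable under j and k.\<close>

lemma gam_compl:
  assumes "z \<noteq> 0" "v \<in> horizontal z"
  shows "gam z y (v - vproj z v) \<bullet> z = 0" "gam z y (v - vproj z v) \<bullet> imult z = 0"
    "gam z y (v - vproj z v) \<bullet> jmult z = 0" "gam z y (v - vproj z v) \<bullet> kmult z = 0"
proof -
  define x where "x = v - vproj z v"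
  have "x \<bullet> z = 0" "x \<bullet> imult z = 0" "x \<bullet> jmult z = 0" "x \<bullet> kmult z = 0"
    using assms by (simp_all add: x_def vproj_compl_inner_jk inner_diff_left vproj_inner_jk horizontal_iff)
  then show "gam z y (v - vproj z v) \<bullet> z = 0" "gam z y (v - vproj z v) \<bullet> imult z = 0"
    "gam z y (v - vproj z v) \<bullet> jmult z = 0" "gam z y (v - vproj z v) \<bullet> kmult z = 0"
    unfolding x_def[symmetric] by (simp_all add: gam_def inner_simps ijk_skew)
qed

lemma gam_compl_horizontal: "z \<noteq> 0 \<Longrightarrow> v \<in> horizontal z \<Longrightarrow> gam z y (v - vproj z v) \<in> horizontal z"
  by (simp add: horizontal_iff gam_compl)

lemma vproj_gam_compl: "z \<noteq> 0 \<Longrightarrow> v \<in> horizontal z \<Longrightarrow> vproj z (gam z y (v - vproj z v)) = 0"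
  unfolding vproj_def[of z "gam z y _"] gam_def[of z "gam z y _"] by (simp add: gam_compl)

lemma vproj_bet: "z \<noteq> 0 \<Longrightarrow> vproj z (bet z x y) = bet z x y"
  by (simp add: vproj_def gam_def bet_def inner_simps ijk_skew)

text \<open>Only the first-distribution component of y enters, and there J is -i; the next lemma is
  the counterpart for the second distribution, where J is i.\<close>

lemma gam_J_lift: "z \<noteq> 0 \<Longrightarrow> gam z (J_lift z y) x = - imult (gam z y x)"
  unfolding J_lift_def gam_imult gam_linear by (simp add: gam_def vproj_inner_jk scaleR_2)

lemma J_lift_compl: "z \<noteq> 0 \<Longrightarrow> J_lift z v - vproj z (J_lift z v) = imult (v - vproj z v)"
  by (simp add: J_lift_def vproj_imult vproj_linear vproj_vproj scaleR_2)

lemma J_lift_horizontal: "z \<noteq> 0 \<Longrightarrow> v \<in> horizontal z \<Longrightarrow> J_lift z v \<in> horizontal z"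
  unfolding J_lift_def by (intro imult_horizontal horizontal_diff horizontal_scaleR vproj_horizontal)

lemma J_lift_linear:
  "J_lift z (u + v) = J_lift z u + J_lift z v" "J_lift z (r *\<^sub>R v) = r *\<^sub>R J_lift z v"
  by (simp_all add: J_lift_def vproj_linear scaleR_add_right scaleR_diff_right)

lemma J_lift_J_lift: "z \<noteq> 0 \<Longrightarrow> J_lift z (J_lift z v) = - v"
  by (simp add: J_lift_def vproj_imult vproj_linear vproj_vproj scaleR_2)

lemma conn_lift_horizontal:
  "z \<noteq> 0 \<Longrightarrow> v \<in> horizontal z \<Longrightarrow> e \<in> horizontal z \<Longrightarrow> conn_lift a z v e w \<in> horizontal z"
  unfolding conn_lift_def
  by (intro horizontal_add hproj_horizontal horizontal_scaleR gam_compl_horizontal)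

lemma g_lift_sym: "g_lift a z v w = g_lift a z w v"
  by (simp add: g_lift_def inner_vproj inner_commute mult.commute)

lemma g_lift_linear:
  "g_lift a z (u + v) w = g_lift a z u w + g_lift a z v w"
  "g_lift a z (r *\<^sub>R v) w = r * g_lift a z v w"
  by (simp_all add: g_lift_def inner_simps algebra_simps flip: add_divide_distrib)

lemma g_lift_pos:
  assumes "a > 0" "z \<noteq> 0" "v \<noteq> 0"
  shows "g_lift a z v v > 0"
proof -
  define x y where "x = vproj z v" and "y = v - vproj z v"
  have v: "v = x + y" by (simp add: x_def y_def)
  have 1: "y \<bullet> x = 0"
    unfolding x_def inner_vproj using assms by (simp add: y_def vproj_compl_inner_jk)
  have "v \<bullet> vproj z v = x \<bullet> x"
    using 1 by (subst (1) v) (simp add: inner_simps flip: x_def)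
  then have "a * (v \<bullet> v) + (1 - a) * (v \<bullet> vproj z v) = a * (y \<bullet> y) + x \<bullet> x"
    using 1 by (simp add: v inner_simps inner_commute[of x y] algebra_simps)
  moreover have "a * (y \<bullet> y) + x \<bullet> x > 0"
    using assms v by (cases "y = 0") (auto intro!: add_pos_nonneg mult_pos_pos)
  ultimately show ?thesis using assms by (simp add: g_lift_def)
qed

text \<open>J is i composed with the reflection \<open>v - 2 *\<^sub>R vproj z v\<close>, a
  Euclidean isometry, and it rotates the pair of inner products with jz and kz by a quarter turn, so
  both terms of the metric are preserved.\<close>

lemma g_lift_J_lift:
  assumes "z \<noteq> 0"
  shows "g_lift a z (J_lift z v) (J_lift z w) = g_lift a z v w"
proof -
  have J: "J_lift z u \<bullet> jmult z = (u - 2 *\<^sub>R vproj z u) \<bullet> (- kmult z)"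
     "J_lift z u \<bullet> kmult z = (u - 2 *\<^sub>R vproj z u) \<bullet> jmult z" for u
    unfolding J_lift_def ijk_skew by simp_all
  have "J_lift z v \<bullet> vproj z (J_lift z w) = v \<bullet> vproj z w"
    unfolding inner_vproj J using assms by (simp add: inner_simps vproj_inner_jk)
  moreover have "J_lift z v \<bullet> J_lift z w = (v - 2 *\<^sub>R vproj z v) \<bullet> (w - 2 *\<^sub>R vproj z w)"
    unfolding J_lift_def imult_inner_imult by simp
  moreover have "\<dots> = v \<bullet> w"
    using assms by (simp add: inner_simps vproj_symmetric vproj_vproj)
  ultimately show ?thesis by (simp add: g_lift_def)
qed

section \<open>Equivariance under nonzero complex scalars\<close>

text \<open>The complex number p + i r acquires the factor c^2, the vector jx the conjugate of c,
  and the denominator |c|^2; the product of these factors is c.\<close>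

lemma gam_cmult:
  assumes "c \<noteq> 0"
  shows "gam (cmult c z) (cmult c y) (cmult c x) = cmult c (gam z y x)"
proof -
  define n where "n = (Re c)\<^sup>2 + (Im c)\<^sup>2"
  have n: "n \<noteq> 0" using assms by (simp add: n_def complex_eq_iff)
  have nz: "cmult c z \<bullet> cmult c z = n * (z \<bullet> z)"
    by (simp add: cmult_inner_cmult n_def cmod_power2)
  define p r where "p = y \<bullet> jmult z" and "r = y \<bullet> kmult z"
  have "cmult c y \<bullet> jmult (cmult c z) = ((Re c)\<^sup>2 - (Im c)\<^sup>2) * p - 2 * Re c * Im c * r"
    "cmult c y \<bullet> kmult (cmult c z) = ((Re c)\<^sup>2 - (Im c)\<^sup>2) * r + 2 * Re c * Im c * p"
    by (simp_all add: cmult_eq inner_simps ijk_skew p_def r_def algebra_simps power2_eq_square)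
  moreover have "s *\<^sub>R (Re c *\<^sub>R jmult x - Im c *\<^sub>R kmult x) + t *\<^sub>R (Re c *\<^sub>R kmult x + Im c *\<^sub>R jmult x)
    = (s * Re c + t * Im c) *\<^sub>R jmult x + (t * Re c - s * Im c) *\<^sub>R kmult x" for s t
    by (simp add: algebra_simps)
  \<comment> \<open>Real and imaginary parts of c^2 (p + i r) times the conjugate of c, which equals
    |c|^2 c (p + i r).\<close>
  moreover have "(((Re c)\<^sup>2 - (Im c)\<^sup>2) * p - 2 * Re c * Im c * r) * Re c + (((Re c)\<^sup>2 - (Im c)\<^sup>2) * r + 2 * Re c * Im c * p) * Im c
      = n * (Re c * p - Im c * r)"
    "(((Re c)\<^sup>2 - (Im c)\<^sup>2) * r + 2 * Re c * Im c * p) * Re c - (((Re c)\<^sup>2 - (Im c)\<^sup>2) * p - 2 * Re c * Im c * r) * Im c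
      = n * (Re c * r + Im c * p)"
    unfolding n_def by algebra+
  ultimately have "gam (cmult c z) (cmult c y) (cmult c x)
    = (n * (Re c * p - Im c * r) / (n * (z \<bullet> z))) *\<^sub>R jmult x + (n * (Re c * r + Im c * p) / (n * (z \<bullet> z))) *\<^sub>R kmult x"
    unfolding gam_def nz by (simp add: cmult_eq flip: add_divide_distrib diff_divide_distrib)
  also have "\<dots> = cmult c (gam z y x)"
    using n by (simp add: gam_def cmult_eq p_def r_def
      add_divide_distrib diff_divide_distrib algebra_simps)
  finally show ?thesis .
qed

lemma vproj_cmult: "c \<noteq> 0 \<Longrightarrow> vproj (cmult c z) (cmult c v) = cmult c (vproj z v)"
  by (simp add: vproj_def gam_cmult)

lemma hproj_cmult:
  assumes "c \<noteq> 0"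
  shows "hproj (cmult c z) (cmult c v) = cmult c (hproj z v)"
  using assms by (simp add: hproj_def cmult_inner_cmult flip: cmult_imult)

lemma J_lift_cmult: "c \<noteq> 0 \<Longrightarrow> J_lift (cmult c z) (cmult c v) = cmult c (J_lift z v)"
  by (simp add: J_lift_def vproj_cmult flip: cmult_imult)

lemma conn_lift_cmult:
  assumes "c \<noteq> 0"
  shows "conn_lift a (cmult c z) (cmult c v) (cmult c e) (cmult c w) = cmult c (conn_lift a z v e w)"
proof -
  have "cmult c x - vproj (cmult c z) (cmult c x) = cmult c (x - vproj z x)" for x
    using assms by (simp add: vproj_cmult)
  then show ?thesis
    unfolding conn_lift_def hproj_cmult[OF assms] by (simp only: gam_cmult[OF assms] cmult_linear(1,4))
qed

lemma horizontal_cmult: "v \<in> horizontal z \<Longrightarrow> cmult c v \<in> horizontal (cmult c z)"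
  by (simp add: horizontal_iff cmult_inner_cmult flip: cmult_imult)

section \<open>Pointwise identities for the connection and for the derivative of J\<close>

text \<open>The correction term is symmetric in v and e, so it cancels.\<close>

lemma conn_lift_torsion: "conn_lift a z v e w - conn_lift a z e v u = hproj z (w - u)"
  by (simp add: conn_lift_def hproj_linear)

text \<open>Metric compatibility at a point: the right-hand side is the derivative of
  \<open>g_lift a z e f\<close> along v when e and f change at the rates w and u. The factor 1/|z|^2
  contributes nothing because v is orthogonal to z.\<close>

lemma conn_lift_metric:
  assumes "a > 0" "z \<noteq> 0" "v \<in> horizontal z" "e \<in> horizontal z" "f \<in> horizontal z"
  shows "g_lift a z (conn_lift a z v e w) f + g_lift a z e (conn_lift a z v f u) =
    (a * (w \<bullet> f + e \<bullet> u) + (1 - a) * (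
        ((w \<bullet> jmult z + e \<bullet> jmult v) * (f \<bullet> jmult z) + (e \<bullet> jmult z) * (u \<bullet> jmult z + f \<bullet> jmult v)
       + (w \<bullet> kmult z + e \<bullet> kmult v) * (f \<bullet> kmult z) + (e \<bullet> kmult z) * (u \<bullet> kmult z + f \<bullet> kmult v)) / (z \<bullet> z))) / (z \<bullet> z)"
proof -
  \<comment> \<open>The correction lies in the second distribution, where the metric carries the
    factor a, so the denominator of (1 - a) / a cancels.\<close>
  have g: "g_lift a z (conn_lift a z v e w) f * (z \<bullet> z) = a * (w \<bullet> f)
      + (1 - a) * (w \<bullet> vproj z f) + (1 - a) * (gam z e (v - vproj z v) \<bullet> f + gam z v (e - vproj z e) \<bullet> f)"
    if "e \<in> horizontal z" "f \<in> horizontal z" for e f w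
  proof -
    have h: "hproj z w \<bullet> f = w \<bullet> f" using that by (simp add: hproj_def inner_simps horizontal_iff inner_commute)
    show ?thesis
      using assms that by (simp add: g_lift_def vproj_symmetric[symmetric] vproj_linear conn_lift_def vproj_hproj vproj_gam_compl h inner_simps
          field_simps)
  qed
  \<comment> \<open>\<open>gam z x (vproj z y)\<close> is a combination of z and iz, hence
    orthogonal to f, so subtracting \<open>vproj z y\<close> has no effect.\<close>
  have k: "gam z x (y - vproj z y) \<bullet> f = - ((x \<bullet> jmult z) * (y \<bullet> jmult f) + (x \<bullet> kmult z) * (y \<bullet> kmult f)) / (z \<bullet> z)"
    if "f \<in> horizontal z" for x y f
    using that assms by (simp add: gam_def vproj_def inner_simps ijk_skew horizontal_iff inner_commute[of z f]
        inner_commute[of "imult z" f] ijk_swap(1)[of z f] divide_simps)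
  have "(g_lift a z (conn_lift a z v e w) f + g_lift a z e (conn_lift a z v f u)) * (z \<bullet> z) =
    (a * (w \<bullet> f + e \<bullet> u) + (1 - a) * (
        ((w \<bullet> jmult z + e \<bullet> jmult v) * (f \<bullet> jmult z) + (e \<bullet> jmult z) * (u \<bullet> jmult z + f \<bullet> jmult v)
       + (w \<bullet> kmult z + e \<bullet> kmult v) * (f \<bullet> kmult z) + (e \<bullet> kmult z) * (u \<bullet> kmult z + f \<bullet> kmult v)) / (z \<bullet> z)))"
    unfolding distrib_right g[OF assms(4,5)] g_lift_sym[of a z e] g[OF assms(5,4)] k[OF assms(4)] k[OF assms(5)]
      inner_vproj
    \<comment> \<open>Skewness of j and k cancels the terms with \<open>v \<bullet> jmult z\<close>
      and \<open>v \<bullet> kmult z\<close>, since these multiply expressions symmetrised in e and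
      f.\<close>
    using assms(2) ijk_swap(2)[of e v] ijk_swap(3)[of e v] ijk_swap(2)[of f v] ijk_swap(3)[of f v]
      ijk_swap(2)[of f e] ijk_swap(3)[of f e]
    by (simp add: inner_commute[of u e] divide_simps) (simp add: algebra_simps)
  then show ?thesis using assms(2) by (simp add: eq_divide_eq)
qed

text \<open>The argument \<open>imult (...)\<close> is the derivative along v of the lift of JY,
  where w is that of the lift of Y (see \<open>J_lift_has_derivative\<close>). Both corrections pick
  up -i in the first term and i in the second, giving -2 i s with s = (1 - a) / a; the Fubini-Study
  part adds -2 i to the \<gamma>(e, v2) term, so the coefficients become 1 + s = 1 / a and s = 1 / a
  - 1.\<close>

lemma nabla_J_lift_eq:
  assumes "a > 0" "z \<noteq> 0" "v \<in> horizontal z" "e \<in> horizontal z"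
  shows "conn_lift a z v (J_lift z e) (imult (w - 2 *\<^sub>R (bet z v e + vproj z w + gam z e v)))
       - J_lift z (conn_lift a z v e w) = nabla_J_lift a z v e"
proof -
  define s where "s = (1 - a) / a"
  define v2 e2 where "v2 = v - vproj z v" and "e2 = e - vproj z e"
  have s: "1 / a = 1 + s" using assms by (simp add: s_def diff_divide_distrib)
  have hb: "hproj z (bet z v e) = bet z v e"
    using vproj_bet[OF assms(2)] hproj_vproj[OF assms(2)] by metis
  \<comment> \<open>The first-distribution part of v contributes a combination of z and iz, which
    \<open>hproj\<close> removes.\<close>
  have hg: "hproj z (gam z e v) = gam z e v2"
  proof -
    have "hproj z (gam z e (vproj z v)) = 0"
      by (simp add: gam_def vproj_def scaleR_add_right scaleR_diff_right hproj_linear hproj_self)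
    then show ?thesis
      using hproj_id[OF gam_compl_horizontal[OF assms(2,3)], of e]
      by (simp add: v2_def gam_linear hproj_linear)
  qed
  have gJ: "gam z (J_lift z e) v2 = - imult (gam z e v2)" "J_lift z e - vproj z (J_lift z e) = imult e2"
    using gam_J_lift J_lift_compl assms(2) by (simp_all add: e2_def)
  have vg: "vproj z (gam z x v2) = 0" "vproj z (gam z x e2) = 0" for x
    using assms by (simp_all add: v2_def e2_def vproj_gam_compl)
  have 1: "conn_lift a z v (J_lift z e) (imult (w - 2 *\<^sub>R (bet z v e + vproj z w + gam z e v)))
      = imult (hproj z w - 2 *\<^sub>R (bet z v e + vproj z w + gam z e v2)) - s *\<^sub>R imult (gam z e v2 + gam z v e2)"
    unfolding conn_lift_def s_def[symmetric] v2_def[symmetric] gJ hproj_imult hproj_linear hb hg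
      hproj_vproj[OF assms(2)] gam_imult
    by (simp add: scaleR_diff_right scaleR_add_right)
  have 2: "J_lift z (conn_lift a z v e w)
      = imult (hproj z w - 2 *\<^sub>R vproj z w) + s *\<^sub>R imult (gam z e v2 + gam z v e2)"
    unfolding conn_lift_def s_def[symmetric] v2_def[symmetric] e2_def[symmetric] J_lift_def vproj_linear vproj_hproj vg
    by (simp add: scaleR_diff_right scaleR_add_right)
  have 3: "(s * 2) *\<^sub>R x = s *\<^sub>R x + s *\<^sub>R x" for x :: c4
    by (simp flip: scaleR_add_left)
  show ?thesis
    unfolding 1 2 nabla_J_lift_def s v2_def[symmetric] e2_def[symmetric]
    by (simp add: algebra_simps scaleR_2 3)
qed

text \<open>On horizontal vectors \<open>bet\<close> sees only second-distribution components, since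
  j and k map the first distribution into the complex line through z. There J is i, and complex
  bilinearity gives the factor -1. In each \<open>gam\<close> term the first argument yields -i and
  the conjugate linear one again -i, with product -1.\<close>

lemma nabla_J_lift_quasi:
  assumes z: "z \<noteq> 0" and h: "v \<in> horizontal z" "e \<in> horizontal z"
  shows "nabla_J_lift a z (J_lift z v) (J_lift z e) = - nabla_J_lift a z v e"
proof -
  have 0: "x \<bullet> jmult (vproj z y) = 0" "x \<bullet> kmult (vproj z y) = 0" if "x \<in> horizontal z" for x y
    using that by (simp_all add: vproj_def gam_def inner_simps horizontal_iff)
  have "J_lift z e \<bullet> jmult (J_lift z v) = - (e \<bullet> jmult v)" "J_lift z e \<bullet> kmult (J_lift z v) = - (e \<bullet> kmult v)"
    using h vproj_horizontal[OF z] ijk_swap(2,3)[of "vproj z e" v]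
    unfolding J_lift_def ijk_mult ijk_skew(1) inner_minus_right
    by (simp_all add: inner_simps 0 ijk_skew)
  then have "bet z (J_lift z v) (J_lift z e) = - bet z v e"
    by (simp add: bet_def)
  then show ?thesis
    unfolding nabla_J_lift_def gam_J_lift[OF z] J_lift_compl[OF z] gam_imult by (simp add: algebra_simps)
qed

text \<open>\<open>bet\<close> is skew and drops out; each \<open>gam\<close> term occurs once with
  coefficient 1/a and once with 1/a - 1.\<close>

lemma nabla_J_lift_swap:
  assumes "z \<noteq> 0"
  shows "nabla_J_lift a z v e + nabla_J_lift a z e v
    = - (2 * (2 / a - 1)) *\<^sub>R imult (gam z e (v - vproj z v) + gam z v (e - vproj z e))"
proof -
  have "bet z e v = - bet z v e"
    by (simp add: bet_def ijk_swap(2)[of v] ijk_swap(3)[of v])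
  then show ?thesis by (simp add: nabla_J_lift_def algebra_simps flip: scaleR_add_left)
qed

subsection \<open>Tangent vectors of the projective space\<close>

lemma hopf_eqD:
  assumes "z \<noteq> 0" "w \<noteq> 0" "hopf z = hopf w"
  obtains c where "c \<noteq> 0" "w = cmult c z"
proof -
  have "range (\<lambda>c. cmult c z) = range (\<lambda>c. cmult c w)"
    using assms Abs_cp3_inject[OF hopf_in[OF assms(1)] hopf_in[OF assms(2)]] by (simp add: hopf_def)
  moreover have "w \<in> range (\<lambda>c. cmult c w)" by (metis cmult_1 rangeI)
  ultimately obtain c where "w = cmult c z" by auto
  then show thesis using assms(2) that by auto
qed

lemma hopf_rep_nonzero [simp]: "hopf_rep p \<noteq> 0"
  using hopf_rep(1)[of p] by auto

lemma hopf_rep_hopf: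
  assumes "z \<noteq> 0"
  obtains c where "c \<noteq> 0" "hopf_rep (hopf z) = cmult c z"
  using hopf_eqD[OF assms hopf_rep_nonzero hopf_rep(2)[symmetric]] .

lemma cp3_exhaust: obtains z where "z \<noteq> 0" "p = hopf z"
  using hopf_rep(2)[of p] hopf_rep_nonzero[of p] by metis

lemma smooth_cp3_has_derivative:
  assumes "f \<in> smooth_cp3" "z \<noteq> 0"
  shows "((\<lambda>z. f (hopf z)) has_derivative (\<lambda>v. dhopf z v f)) (at z)"
  using smooth_on_has_derivative[of "-{0}" "\<lambda>z. f (hopf z)" z] assms
  by (simp add: smooth_cp3_def dhopf_def)

lemma dhopf_not_smooth: "f \<notin> smooth_cp3 \<Longrightarrow> dhopf z v f = 0"
  by (simp add: dhopf_def)

lemma dhopf_linear_apply: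
  assumes "z \<noteq> 0"
  shows "linear (\<lambda>v. dhopf z v f)"
proof (cases "f \<in> smooth_cp3")
  case True
  then show ?thesis using smooth_cp3_has_derivative[OF True assms] has_derivative_linear by blast
qed (simp add: dhopf_not_smooth linear_iff)

lemma dhopf_add: "z \<noteq> 0 \<Longrightarrow> dhopf z (u + v) = dhopf z u + dhopf z v"
  and dhopf_diff: "z \<noteq> 0 \<Longrightarrow> dhopf z (u - v) = dhopf z u - dhopf z v"
  and dhopf_minus: "z \<noteq> 0 \<Longrightarrow> dhopf z (- v) = - dhopf z v"
  and dhopf_scaleR: "z \<noteq> 0 \<Longrightarrow> dhopf z (r *\<^sub>R v) = tscale r (dhopf z v)"
  and dhopf_0: "z \<noteq> 0 \<Longrightarrow> dhopf z 0 = 0"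
  by (auto intro!: ext simp: tscale_def linear_add[OF dhopf_linear_apply] linear_diff[OF dhopf_linear_apply]
      linear_neg[OF dhopf_linear_apply] linear_cmul[OF dhopf_linear_apply] linear_0[OF dhopf_linear_apply])

text \<open>A function pulled back by \<open>hopf\<close> is constant along z + t a z = (1 + t a) z
  as long as 1 + t a is nonzero, which holds for small t.\<close>

lemma dhopf_vertical:
  assumes "z \<noteq> 0"
  shows "dhopf z z = 0" "dhopf z (imult z) = 0"
proof -
  have *: "dhopf z (cmult a z) f = 0" for a f
  proof (cases "f \<in> smooth_cp3")
    case True
    have ev: "\<forall>\<^sub>F t in nhds 0. f (hopf (z + t *\<^sub>R cmult a z)) = f (hopf z)"
    proof -
      have "\<forall>\<^sub>F t::real in nhds 0. norm (1 + of_real t * a) > 0"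
        by (intro order_tendstoD(1)[where y = "norm (1 + of_real 0 * a)"] tendsto_intros filterlim_ident) auto
      then show ?thesis
      proof (rule eventually_mono)
        fix t :: real assume "norm (1 + of_real t * a) > 0"
        moreover have "z + t *\<^sub>R cmult a z = cmult (1 + of_real t * a) z"
          by (simp add: cmult_eq algebra_simps)
        ultimately show "f (hopf (z + t *\<^sub>R cmult a z)) = f (hopf z)"
          using hopf_cmult by auto
      qed
    qed
    have "((\<lambda>t. z + t *\<^sub>R cmult a z) has_derivative (\<lambda>t. t *\<^sub>R cmult a z)) (at 0)"
      by (auto intro!: derivative_eq_intros)
    from diff_chain_at[OF this, of "\<lambda>z. f (hopf z)" "\<lambda>v. dhopf z v f"]
    have "((\<lambda>t. f (hopf (z + t *\<^sub>R cmult a z))) has_derivative (\<lambda>t. dhopf z (t *\<^sub>R cmult a z) f)) (at 0)"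
      using smooth_cp3_has_derivative[OF True assms] by (simp add: o_def)
    then have "((\<lambda>t. f (hopf z)) has_derivative (\<lambda>t. dhopf z (t *\<^sub>R cmult a z) f)) (at 0)"
      by (rule has_derivative_transform_eventually[where s = UNIV])
        (use ev in \<open>auto simp: eventually_at_filter elim: eventually_mono\<close>)
    then have "(\<lambda>t. dhopf z (t *\<^sub>R cmult a z) f) = (\<lambda>t. 0)"
      using has_derivative_const has_derivative_unique by blast
    from fun_cong[OF this, of 1] show ?thesis by simp
  qed (simp add: dhopf_not_smooth)
  from *[of 1] *[of \<i>] show "dhopf z z = 0" "dhopf z (imult z) = 0"
    by (auto simp: cmult_eq)
qed

lemma dhopf_hproj: "z \<noteq> 0 \<Longrightarrow> dhopf z (hproj z v) = dhopf z v"
  by (simp add: hproj_def dhopf_diff dhopf_scaleR dhopf_vertical tscale_def zero_fun_def fun_diff_def)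

text \<open>The real part of the Hermitian matrix coefficient \<open>\<langle>u, z\<rangle> \<langle>z, w\<rangle> / |z|^2\<close> of the orthogonal
  projection onto the complex line through \<open>z\<close>.\<close>

definition coef :: "c4 \<Rightarrow> c4 \<Rightarrow> cp3 \<Rightarrow> real" where
  "coef u w p = (let z = hopf_rep p in (z \<bullet> u) * (z \<bullet> w) + (z \<bullet> imult u) * (z \<bullet> imult w))"

text \<open>The chosen representative is c z with |c|^2 = 1/|z|^2, and the numerator scales by
  |c|^2.\<close>

lemma coef_hopf:
  assumes "z \<noteq> 0"
  shows "coef u w (hopf z) = ((z \<bullet> u) * (z \<bullet> w) + (z \<bullet> imult u) * (z \<bullet> imult w)) / (z \<bullet> z)"
proof -
  obtain c where c: "c \<noteq> 0" "hopf_rep (hopf z) = cmult c z" using hopf_rep_hopf[OF assms] .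
  define n where "n = (Re c)\<^sup>2 + (Im c)\<^sup>2"
  have n: "n * (z \<bullet> z) = 1"
    using hopf_rep(1)[of "hopf z"] cmult_inner_cmult[of c z z] by (simp add: c n_def cmod_power2 norm_eq_1)
  have "coef u w (hopf z) = n * ((z \<bullet> u) * (z \<bullet> w) + (z \<bullet> imult u) * (z \<bullet> imult w))"
    by (simp add: coef_def c Let_def cmult_eq inner_simps ijk_skew n_def algebra_simps power2_eq_square)
  also have "n = 1 / (z \<bullet> z)" using n assms by (simp add: field_simps)
  finally show ?thesis by simp
qed

lemma open_nonzero [simp]: "open (- {0::c4})"
  by auto

lemma coef_smooth: "coef u w \<in> smooth_cp3"
proof -
  have "smooth_on (-{0}) (\<lambda>z. ((z \<bullet> u) * (z \<bullet> w) + (z \<bullet> imult u) * (z \<bullet> imult w)) / (z \<bullet> z))"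
    by (intro smooth_on_divide smooth_on_add smooth_on_mult smooth_on_inner smooth_on_ident smooth_on_const
        open_nonzero) auto
  then show ?thesis
    unfolding smooth_cp3_def using smooth_on_cong[OF open_nonzero, of "\<lambda>z. coef u w (hopf z)"] coef_hopf by simp
qed

text \<open>The quotient rule in a form where the contribution of the denominator carries the factor
  \<open>v \<bullet> z\<close> and hence vanishes on horizontal vectors.\<close>

lemma has_derivative_div_norm:
  fixes N :: "c4 \<Rightarrow> real"
  assumes "(N has_derivative N') (at z)" "z \<noteq> 0"
  shows "((\<lambda>z. N z / (z \<bullet> z)) has_derivative (\<lambda>v. (N' v - N z / (z \<bullet> z) * (2 * (v \<bullet> z))) / (z \<bullet> z))) (at z)"
  using assms by (auto intro!: derivative_eq_intros simp: field_simps inner_commute)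

lemma dhopf_coef:
  assumes "z \<noteq> 0" "v \<in> horizontal z"
  shows "dhopf z v (coef u w) =
    ((v \<bullet> u) * (z \<bullet> w) + (z \<bullet> u) * (v \<bullet> w) + (v \<bullet> imult u) * (z \<bullet> imult w) + (z \<bullet> imult u) * (v \<bullet> imult w)) / (z \<bullet> z)"
proof -
  have 1: "((\<lambda>z. (z \<bullet> u) * (z \<bullet> w) + (z \<bullet> imult u) * (z \<bullet> imult w)) has_derivative
    (\<lambda>v. (v \<bullet> u) * (z \<bullet> w) + (z \<bullet> u) * (v \<bullet> w) + (v \<bullet> imult u) * (z \<bullet> imult w) + (z \<bullet> imult u) * (v \<bullet> imult w))) (at z)"
    by (auto intro!: derivative_eq_intros simp: algebra_simps)
  have "((\<lambda>z. coef u w (hopf z)) has_derivative (\<lambda>v.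
    (((v \<bullet> u) * (z \<bullet> w) + (z \<bullet> u) * (v \<bullet> w) + (v \<bullet> imult u) * (z \<bullet> imult w) + (z \<bullet> imult u) * (v \<bullet> imult w))
      - ((z \<bullet> u) * (z \<bullet> w) + (z \<bullet> imult u) * (z \<bullet> imult w)) / (z \<bullet> z) * (2 * (v \<bullet> z))) / (z \<bullet> z))) (at z)"
    by (rule has_derivative_transform_within_open[OF has_derivative_div_norm[OF 1 assms(1)], of "-{0}"])
      (use assms(1) coef_hopf in auto)
  from fun_cong[OF has_derivative_unique[OF smooth_cp3_has_derivative[OF coef_smooth assms(1)] this], of v]
  show ?thesis using assms(2) by (simp add: horizontal_iff)
qed

lemma dhopf_inj_on:
  assumes "z \<noteq> 0"
  shows "inj_on (dhopf z) (horizontal z)"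
proof (rule inj_onI)
  fix u w assume "u \<in> horizontal z" "w \<in> horizontal z" and eq: "dhopf z u = dhopf z w"
  then have v: "u - w \<in> horizontal z" by (simp add: horizontal_diff)
  have "dhopf z (u - w) = 0" using eq dhopf_diff[OF assms] by simp
  \<comment> \<open>The test function is chosen so that, by \<open>dhopf_coef\<close>, its
    derivative along u - w is the squared norm of u - w.\<close>
  then have "dhopf z (u - w) (coef (u - w) z) = 0" by simp
  then have "(u - w) \<bullet> (u - w) = 0"
    using dhopf_coef[OF assms v, of "u - w" z] v assms ijk_swap(1)[of z "u - w"]
    by (simp add: horizontal_iff)
  then show "u = w" by simp
qed

lemma hlift_dhopf: "z \<noteq> 0 \<Longrightarrow> v \<in> horizontal z \<Longrightarrow> hlift z (dhopf z v) = v"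
  unfolding hlift_def by (rule the_equality) (auto dest: inj_onD[OF dhopf_inj_on])

text \<open>A smooth curve \<open>\<gamma>\<close> is lifted to \<open>C^4\<close> near \<open>0\<close> by projecting a fixed point of the line
  \<open>\<gamma> 0\<close> orthogonally onto the lines \<open>\<gamma> t\<close>.\<close>

lemma tangent_space_hopf:
  assumes "z \<noteq> 0"
  shows "tangent_space smooth_cp3 (hopf z) = dhopf z ` horizontal z"
proof (intro equalityI subsetI)
  fix u assume "u \<in> tangent_space smooth_cp3 (hopf z)"
  then obtain \<gamma> where \<gamma>: "smooth_curve smooth_cp3 \<gamma>" "\<gamma> 0 = hopf z" "u = velocity smooth_cp3 \<gamma>"
    by (auto simp: tangent_space_def)
  \<comment> \<open>The coordinates of the projected point are values of the smooth functions
    \<open>coef z b\<close>, so smoothness of the curve passes to y.\<close>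
  define y where "y t = (\<Sum>b\<in>Basis. coef z b (\<gamma> t) *\<^sub>R b)" for t
  have y: "\<exists>c. y t = cmult c q" if "\<gamma> t = hopf q" "q \<noteq> 0" for t q
  proof -
    have "y t = (\<Sum>b\<in>Basis. (((1 / (q \<bullet> q)) *\<^sub>R ((q \<bullet> z) *\<^sub>R q - (q \<bullet> imult z) *\<^sub>R imult q)) \<bullet> b) *\<^sub>R b)"
      unfolding y_def that coef_hopf[OF that(2)]
      by (intro sum.cong) (simp_all add: inner_simps ijk_skew)
    also have "\<dots> = (1 / (q \<bullet> q)) *\<^sub>R ((q \<bullet> z) *\<^sub>R q - (q \<bullet> imult z) *\<^sub>R imult q)"
      by (rule euclidean_representation)
    also have "\<dots> = cmult (Complex (q \<bullet> z / (q \<bullet> q)) (- (q \<bullet> imult z) / (q \<bullet> q))) q"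
      by (simp add: cmult_eq scaleR_diff_right)
    finally show ?thesis by blast
  qed
  have y0: "y 0 = z"
  proof -
    have "y 0 = (\<Sum>b\<in>Basis. (z \<bullet> b) *\<^sub>R b)"
      unfolding y_def \<gamma>(2) coef_hopf[OF assms] using assms by (intro sum.cong) simp_all
    then show ?thesis by (simp add: euclidean_representation)
  qed
  have "smooth_on UNIV (\<lambda>t. coef z b (\<gamma> t))" for b
    using \<gamma>(1) coef_smooth by (auto simp: smooth_curve_def)
  then have "smooth_on UNIV y"
    unfolding y_def by (intro smooth_on_sum smooth_on_scaleR smooth_on_const open_UNIV)
  then obtain y' where y': "(y has_derivative y') (at 0)"
    using smooth_on_has_derivative by blast
  have "isCont y 0" using y' has_derivative_continuous by blast
  then have "\<forall>\<^sub>F t in at 0. y t \<noteq> 0"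
    using y0 assms tendsto_imp_eventually_ne[of y z "at 0" 0] by (simp add: isCont_def)
  then have nz: "\<forall>\<^sub>F t in nhds 0. y t \<noteq> 0"
    using y0 assms by (simp add: eventually_nhds_conv_at)
  have hy: "\<forall>\<^sub>F t in nhds 0. hopf (y t) = \<gamma> t"
    using nz
  proof (rule eventually_mono)
    fix t assume t: "y t \<noteq> 0"
    obtain q where q: "q \<noteq> 0" "\<gamma> t = hopf q" using cp3_exhaust .
    then obtain c where "y t = cmult c q" using y by blast
    then show "hopf (y t) = \<gamma> t" using t q hopf_cmult by auto
  qed
  have "u = dhopf z (y' 1)"
  proof
    fix f show "u f = dhopf z (y' 1) f"
    proof (cases "f \<in> smooth_cp3")
      case True
      have "((\<lambda>z. f (hopf z)) has_derivative (\<lambda>v. dhopf z v f)) (at (y 0))"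
        unfolding y0 using True assms by (rule smooth_cp3_has_derivative)
      from diff_chain_at[OF y' this]
      have *: "((\<lambda>t. f (hopf (y t))) has_derivative (\<lambda>t. dhopf z (y' t) f)) (at 0)"
        by (simp add: o_def)
      have eq: "(\<lambda>t. dhopf z (y' t) f) = (*) (dhopf z (y' 1) f)"
      proof
        fix t :: real
        have "y' t = t *\<^sub>R y' 1"
          using linear_cmul[OF has_derivative_linear[OF y'], of t 1] by simp
        then show "dhopf z (y' t) f = dhopf z (y' 1) f * t"
          using linear_cmul[OF dhopf_linear_apply[OF assms], of t "y' 1" f] by simp
      qed
      have "((\<lambda>t. f (hopf (y t))) has_real_derivative dhopf z (y' 1) f) (at 0)"
        unfolding has_field_derivative_def eq[symmetric] by (rule *)
      moreover have "\<forall>\<^sub>F t in nhds 0. f (hopf (y t)) = f (\<gamma> t)"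
        using hy by (rule eventually_mono) simp
      ultimately have "((\<lambda>t. f (\<gamma> t)) has_real_derivative dhopf z (y' 1) f) (at 0)"
        by (simp add: DERIV_cong_ev[OF refl _ refl])
      then show ?thesis using True by (simp add: \<gamma>(3) velocity_def DERIV_imp_deriv)
    qed (simp add: \<gamma>(3) velocity_def dhopf_not_smooth)
  qed
  also have "\<dots> = dhopf z (hproj z (y' 1))" using dhopf_hproj[OF assms] by simp
  finally show "u \<in> dhopf z ` horizontal z" using hproj_horizontal[OF assms] by blast
next
  fix u assume "u \<in> dhopf z ` horizontal z"
  then obtain v where v: "v \<in> horizontal z" "u = dhopf z v" by blast
  \<comment> \<open>The line z + t v represents the tangent vector. Horizontality keeps it off 0 for
    every t, as \<open>smooth_curve\<close> requires smoothness on all of the real line.\<close>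
  have nz: "z + t *\<^sub>R v \<noteq> 0" for t
  proof
    assume "z + t *\<^sub>R v = 0"
    then have "(z + t *\<^sub>R v) \<bullet> z = 0" by simp
    then show False using v assms by (simp add: inner_simps horizontal_iff)
  qed
  define \<gamma> where "\<gamma> t = hopf (z + t *\<^sub>R v)" for t
  have "smooth_on UNIV (\<lambda>t. f (\<gamma> t))" if "f \<in> smooth_cp3" for f
    using that nz Ck_on_affine_line[OF open_nonzero, of z v _ "\<lambda>z. f (hopf z)"]
    by (simp add: smooth_cp3_def smooth_on_def \<gamma>_def)
  then have "smooth_curve smooth_cp3 \<gamma>" by (simp add: smooth_curve_def)
  moreover have "velocity smooth_cp3 \<gamma> = u"
  proof
    fix f show "velocity smooth_cp3 \<gamma> f = u f"
    proof (cases "f \<in> smooth_cp3")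
      case True
      have "((\<lambda>t. z + t *\<^sub>R v) has_derivative (\<lambda>t. t *\<^sub>R v)) (at 0)"
        by (auto intro!: derivative_eq_intros)
      from diff_chain_at[OF this, of "\<lambda>z. f (hopf z)" "\<lambda>v. dhopf z v f"]
      have "((\<lambda>t. f (\<gamma> t)) has_real_derivative dhopf z v f) (at 0)"
        using smooth_cp3_has_derivative[OF True assms] linear_cmul[OF dhopf_linear_apply[OF assms]]
        unfolding has_field_derivative_def by (simp add: o_def \<gamma>_def mult_commute_abs)
      then show ?thesis using True by (simp add: velocity_def v DERIV_imp_deriv)
    qed (simp add: velocity_def v dhopf_not_smooth)
  qed
  ultimately show "u \<in> tangent_space smooth_cp3 (hopf z)"
    unfolding tangent_space_def by (auto simp: \<gamma>_def intro!: exI[of _ \<gamma>])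
qed

section \<open>The distributions, metric and almost complex structure in terms of horizontal
  lifts\<close>

lemma D1_rep: "D1 (hopf z) = dhopf (hopf_rep (hopf z)) ` range (vproj (hopf_rep (hopf z)))"
proof -
  define q where "q = hopf_rep (hopf z)"
  have q: "q \<bullet> q = 1" "q \<noteq> 0" using hopf_rep(1) by (auto simp: q_def norm_eq_1)
  have "span {jmult q, kmult q} = range (vproj q)"
  proof (intro equalityI subsetI)
    fix v assume "v \<in> span {jmult q, kmult q}"
    then obtain s t where "v = s *\<^sub>R jmult q + t *\<^sub>R kmult q"
      by (auto simp: span_insert span_singleton algebra_simps)
    then have "v = vproj q v"
      using q by (simp add: vproj_def gam_def inner_simps ijk_skew)
    then show "v \<in> range (vproj q)" by auto
  next
    fix v assume "v \<in> range (vproj q)"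
    then obtain y where "v = vproj q y" by blast
    then show "v \<in> span {jmult q, kmult q}"
      unfolding vproj_def gam_def by (auto intro: span_add span_scale span_base)
  qed
  then show ?thesis by (simp add: D1_def q_def Let_def)
qed

lemma D2_rep: "D2 (hopf z) = dhopf (hopf_rep (hopf z)) ` {v \<in> horizontal (hopf_rep (hopf z)). vproj (hopf_rep (hopf z)) v = 0}"
proof -
  define q where "q = hopf_rep (hopf z)"
  have q: "q \<bullet> q = 1" "q \<noteq> 0" using hopf_rep(1) by (auto simp: q_def norm_eq_1)
  have "v \<in> (span {imult q, jmult q, kmult q})\<^sup>\<bottom> \<longleftrightarrow> v \<bullet> imult q = 0 \<and> v \<bullet> jmult q = 0 \<and> v \<bullet> kmult q = 0" for v
  proof -
    have "imult q \<in> span {imult q, jmult q, kmult q}" "jmult q \<in> span {imult q, jmult q, kmult q}"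
      "kmult q \<in> span {imult q, jmult q, kmult q}"
      by (auto intro: span_base)
    moreover have "y \<bullet> v = 0" if "v \<bullet> imult q = 0 \<and> v \<bullet> jmult q = 0 \<and> v \<bullet> kmult q = 0"
      "y \<in> span {imult q, jmult q, kmult q}" for y
    proof -
      have "orthogonal v y"
        by (rule orthogonal_to_span[OF that(2)]) (use that(1) in \<open>auto simp: orthogonal_def\<close>)
      then show ?thesis by (simp add: orthogonal_def inner_commute)
    qed
    ultimately show ?thesis
      unfolding orthogonal_comp_def orthogonal_def mem_Collect_eq by (metis inner_commute)
  qed
  moreover have "vproj q v = 0 \<longleftrightarrow> v \<bullet> jmult q = 0 \<and> v \<bullet> kmult q = 0" for v
    using vproj_inner_jk[OF q(2), of v] by (auto simp: vproj_def gam_def)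
  moreover have "v \<in> tangent_S7 q \<longleftrightarrow> v \<bullet> q = 0" for v
    by (simp add: tangent_S7_def orthogonal_comp_def orthogonal_def inner_commute)
  ultimately have "tangent_S7 q \<inter> (span {imult q, jmult q, kmult q})\<^sup>\<bottom> = {v \<in> horizontal q. vproj q v = 0}"
    unfolding set_eq_iff Int_iff mem_Collect_eq horizontal_iff by blast
  then show ?thesis by (simp add: D2_def q_def Let_def)
qed

text \<open>The description is resolved at the chosen representative q = c z, where both
  distributions are known, and equivariance of \<open>vproj\<close> and \<open>dhopf\<close> carries
  the result back to z. The lemmas on \<open>J1\<close> and \<open>g1\<close> use the same
  transport.\<close>

lemma part1_hopf:
  assumes "z \<noteq> 0" "v \<in> horizontal z"
  shows "part1 (hopf z) (dhopf z v) = dhopf z (vproj z v)"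
proof -
  obtain c where c: "c \<noteq> 0" "hopf_rep (hopf z) = cmult c z" using hopf_rep_hopf[OF assms(1)] .
  define q where "q = hopf_rep (hopf z)"
  have q: "q \<noteq> 0" by (simp add: q_def)
  define x where "x = cmult c v"
  have x: "x \<in> horizontal q" using horizontal_cmult[OF assms(2)] by (simp add: x_def q_def c)
  have "part1 (hopf z) (dhopf q x) = dhopf q (vproj q x)"
    unfolding part1_def D1_rep D2_rep q_def[symmetric]
  proof (rule the_equality, intro conjI)
    show "dhopf q (vproj q x) \<in> dhopf q ` range (vproj q)" by blast
    have "dhopf q x - dhopf q (vproj q x) = dhopf q (x - vproj q x)" by (simp add: dhopf_diff q)
    moreover have "x - vproj q x \<in> {v \<in> horizontal q. vproj q v = 0}"
      using x q by (simp add: horizontal_diff vproj_horizontal vproj_linear vproj_vproj)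
    ultimately show "dhopf q x - dhopf q (vproj q x) \<in> dhopf q ` {v \<in> horizontal q. vproj q v = 0}" by blast
  next
    fix u assume u: "u \<in> dhopf q ` range (vproj q) \<and> dhopf q x - u \<in> dhopf q ` {v \<in> horizontal q. vproj q v = 0}"
    then obtain y w where y: "u = dhopf q (vproj q y)" and w: "w \<in> horizontal q" "vproj q w = 0"
      "dhopf q x - u = dhopf q w" by auto
    then have "dhopf q (x - vproj q y) = dhopf q w" by (simp add: dhopf_diff q)
    then have "x - vproj q y = w"
      using dhopf_inj_on[OF q] w(1) x q by (auto dest!: inj_onD simp: horizontal_diff vproj_horizontal)
    then have "x = vproj q y + w" by (simp add: algebra_simps)
    then have "vproj q x = vproj q y" using w(2) q by (simp add: vproj_linear vproj_vproj)
    then show "u = dhopf q (vproj q x)" by (simp add: y)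
  qed
  then show ?thesis
    using assms(1) c by (simp add: q_def x_def vproj_cmult dhopf_cmult)
qed

lemma part2_hopf:
  "z \<noteq> 0 \<Longrightarrow> v \<in> horizontal z \<Longrightarrow> part2 (hopf z) (dhopf z v) = dhopf z (v - vproj z v)"
  by (simp add: part2_def part1_hopf dhopf_diff)

lemma J1_hopf:
  assumes "z \<noteq> 0" "v \<in> horizontal z"
  shows "J1 (hopf z) (dhopf z v) = dhopf z (imult v)"
proof -
  obtain c where c: "c \<noteq> 0" "hopf_rep (hopf z) = cmult c z" using hopf_rep_hopf[OF assms(1)] .
  then have "hlift (cmult c z) (dhopf z v) = cmult c v"
    using hlift_dhopf[of "cmult c z" "cmult c v"] horizontal_cmult[OF assms(2)] assms(1)
    by (simp add: dhopf_cmult)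
  then show ?thesis
    using c assms by (simp add: J1_def Let_def dhopf_cmult flip: cmult_imult)
qed

lemma g1_hopf:
  assumes "z \<noteq> 0" "v \<in> horizontal z" "w \<in> horizontal z"
  shows "g1 (hopf z) (dhopf z v) (dhopf z w) = (v \<bullet> w) / (z \<bullet> z)"
proof -
  obtain c where c: "c \<noteq> 0" "hopf_rep (hopf z) = cmult c z" using hopf_rep_hopf[OF assms(1)] .
  then have "hlift (cmult c z) (dhopf z v) = cmult c v" if "v \<in> horizontal z" for v
    using hlift_dhopf[of "cmult c z" "cmult c v"] horizontal_cmult[OF that] assms(1)
    by (simp add: dhopf_cmult)
  moreover have "(cmod c)\<^sup>2 * (z \<bullet> z) = 1"
    using hopf_rep(1)[of "hopf z"] cmult_inner_cmult[of c z z] by (simp add: c norm_eq_1)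
  ultimately show ?thesis
    using c assms by (simp add: g1_def cmult_inner_cmult field_simps)
qed

lemma J_cp3_hopf:
  assumes "z \<noteq> 0" "v \<in> horizontal z"
  shows "J_cp3 (hopf z) (dhopf z v) = dhopf z (J_lift z v)"
proof -
  have "J_cp3 (hopf z) (dhopf z v) = - dhopf z (imult (vproj z v)) + dhopf z (imult (v - vproj z v))"
    unfolding J_cp3_def part1_hopf[OF assms] part2_hopf[OF assms]
      J1_hopf[OF assms(1) vproj_horizontal[OF assms(1)]]
      J1_hopf[OF assms(1) horizontal_diff[OF assms(2) vproj_horizontal[OF assms(1)]]] ..
  also have "\<dots> = dhopf z (imult (v - vproj z v) - imult (vproj z v))"
    unfolding dhopf_diff[OF assms(1), of "imult (v - vproj z v)" "imult (vproj z v)"] by simp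
  also have "imult (v - vproj z v) - imult (vproj z v) = J_lift z v"
    by (simp add: J_lift_def scaleR_2)
  finally show ?thesis .
qed

lemma g_cp3_hopf:
  assumes "z \<noteq> 0" "v \<in> horizontal z" "w \<in> horizontal z"
  shows "g_cp3 a (hopf z) (dhopf z v) (dhopf z w) = g_lift a z v w"
proof -
  have "vproj z v \<bullet> vproj z w = v \<bullet> vproj z w"
    using assms by (simp add: vproj_symmetric vproj_vproj)
  moreover have "(v - vproj z v) \<bullet> (w - vproj z w) = v \<bullet> w - v \<bullet> vproj z w"
    using assms by (simp add: inner_simps vproj_symmetric vproj_vproj)
  ultimately show ?thesis
    using assms by (simp add: g_cp3_def part1_hopf part2_hopf g1_hopf vproj_horizontal horizontal_diff
      g_lift_def algebra_simps flip: add_divide_distrib)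
qed

subsection \<open>Vector fields\<close>

text \<open>Equivariance is what makes the projection of \<xi> z to CP^3 depend on
  \<open>hopf z\<close> alone.\<close>

definition horizontal_field :: "(c4 \<Rightarrow> c4) \<Rightarrow> bool" where
  "horizontal_field \<xi> \<longleftrightarrow> smooth_on (- {0}) \<xi> \<and>
     (\<forall>z. z \<noteq> 0 \<longrightarrow> \<xi> z \<in> horizontal z \<and> (\<forall>c. c \<noteq> 0 \<longrightarrow> \<xi> (cmult c z) = cmult c (\<xi> z)))"

definition descend :: "(c4 \<Rightarrow> c4) \<Rightarrow> cp3 vfield" where
  "descend \<xi> p = dhopf (hopf_rep p) (\<xi> (hopf_rep p))"

definition field_lift :: "cp3 vfield \<Rightarrow> c4 \<Rightarrow> c4" where
  "field_lift X z = hlift z (X (hopf z))"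

lemma horizontal_fieldI:
  assumes "smooth_on (- {0}) \<xi>" "\<And>z. z \<noteq> 0 \<Longrightarrow> \<xi> z \<in> horizontal z"
    "\<And>z c. z \<noteq> 0 \<Longrightarrow> c \<noteq> 0 \<Longrightarrow> \<xi> (cmult c z) = cmult c (\<xi> z)"
  shows "horizontal_field \<xi>"
  unfolding horizontal_field_def using assms by blast

lemma horizontal_fieldD:
  assumes "horizontal_field \<xi>"
  shows "smooth_on (- {0}) \<xi>" "z \<noteq> 0 \<Longrightarrow> \<xi> z \<in> horizontal z"
    "z \<noteq> 0 \<Longrightarrow> c \<noteq> 0 \<Longrightarrow> \<xi> (cmult c z) = cmult c (\<xi> z)"
  using assms by (simp_all add: horizontal_field_def del: split_paired_All)

lemma descend_hopf:
  assumes "horizontal_field \<xi>" "z \<noteq> 0"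
  shows "descend \<xi> (hopf z) = dhopf z (\<xi> z)"
proof -
  obtain c where "c \<noteq> 0" "hopf_rep (hopf z) = cmult c z" using hopf_rep_hopf[OF assms(2)] .
  then show ?thesis using assms by (simp add: descend_def horizontal_fieldD dhopf_cmult)
qed

lemma descend_vfields:
  assumes "horizontal_field \<xi>"
  shows "descend \<xi> \<in> vfields smooth_cp3"
  unfolding vfields_def
proof (intro CollectI conjI allI ballI)
  fix p
  obtain z where z: "z \<noteq> 0" "p = hopf z" using cp3_exhaust .
  show "descend \<xi> p \<in> tangent_space smooth_cp3 p"
    using assms z by (simp add: descend_hopf tangent_space_hopf horizontal_fieldD)
next
  fix f assume f: "f \<in> smooth_cp3"
  then have "smooth_on (-{0}) (\<lambda>z. frechet_derivative (\<lambda>z. f (hopf z)) (at z) (\<xi> z))"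
    using horizontal_fieldD(1)[OF assms]
    by (intro smooth_on_frechet_derivative) (auto simp: smooth_cp3_def)
  moreover have "descend \<xi> (hopf z) f = frechet_derivative (\<lambda>z. f (hopf z)) (at z) (\<xi> z)" if "z \<in> - {0}" for z
    using that f assms by (simp add: descend_hopf dhopf_def)
  ultimately show "(\<lambda>p. descend \<xi> p f) \<in> smooth_cp3"
    using smooth_on_cong[OF open_nonzero, of "\<lambda>z. descend \<xi> (hopf z) f"] by (simp add: smooth_cp3_def)
qed

lemma field_lift_descend: "horizontal_field \<xi> \<Longrightarrow> z \<noteq> 0 \<Longrightarrow> field_lift (descend \<xi>) z = \<xi> z"
  by (simp add: field_lift_def descend_hopf hlift_dhopf horizontal_fieldD)

text \<open>Smoothness of the lift x is recovered from the action of X on functions: contracting the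
  derivative of \<open>coef b e\<close> with the coordinates of z over b leaves
  \<open>x \<bullet> e\<close>, as the remaining terms contain inner products of z with x, ix or iz,
  which vanish.\<close>

lemma
  assumes "X \<in> vfields smooth_cp3"
  shows vfield_hopf: "z \<noteq> 0 \<Longrightarrow> X (hopf z) = dhopf z (field_lift X z)"
    and horizontal_field_lift: "horizontal_field (field_lift X)"
proof -
  have 1: "\<exists>v. v \<in> horizontal z \<and> X (hopf z) = dhopf z v" if "z \<noteq> 0" for z
    using assms tangent_space_hopf[OF that] unfolding vfields_def by blast
  have *: "field_lift X z \<in> horizontal z \<and> X (hopf z) = dhopf z (field_lift X z)" if z: "z \<noteq> 0" for z
    using 1[OF z] hlift_dhopf[OF z] by (auto simp: field_lift_def)
  then show "z \<noteq> 0 \<Longrightarrow> X (hopf z) = dhopf z (field_lift X z)" by blast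
  have hom: "field_lift X (cmult c z) = cmult c (field_lift X z)" if "z \<noteq> 0" "c \<noteq> 0" for z c
  proof -
    have "X (hopf (cmult c z)) = dhopf (cmult c z) (cmult c (field_lift X z))"
      using * that by (simp add: hopf_cmult dhopf_cmult)
    then show ?thesis
      unfolding field_lift_def[of X "cmult c z"]
      using * that by (simp add: hlift_dhopf horizontal_cmult)
  qed
  have "field_lift X z = (\<Sum>e\<in>Basis. (\<Sum>b\<in>Basis. (z \<bullet> b) * X (hopf z) (coef b e)) *\<^sub>R e)" if z: "z \<noteq> 0" for z
  proof -
    define x where "x = field_lift X z"
    have x: "x \<in> horizontal z" "X (hopf z) = dhopf z x" using *[OF z] by (auto simp: x_def)
    have "(\<Sum>b\<in>Basis. (z \<bullet> b) * X (hopf z) (coef b e)) = x \<bullet> e" for e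
    proof -
      have "(\<Sum>b\<in>Basis. (z \<bullet> b) * X (hopf z) (coef b e))
        = (\<Sum>b\<in>Basis. ((x \<bullet> b) * (z \<bullet> b) * (z \<bullet> e) + (z \<bullet> b) * (z \<bullet> b) * (x \<bullet> e)
           - (imult x \<bullet> b) * (z \<bullet> b) * (z \<bullet> imult e) - (imult z \<bullet> b) * (z \<bullet> b) * (x \<bullet> imult e)) / (z \<bullet> z))"
        unfolding x(2) dhopf_coef[OF z x(1)] by (intro sum.cong) (simp_all add: ijk_skew algebra_simps)
      also have "\<dots> = ((x \<bullet> z) * (z \<bullet> e) + (z \<bullet> z) * (x \<bullet> e) - (imult x \<bullet> z) * (z \<bullet> imult e) - (imult z \<bullet> z) * (x \<bullet> imult e)) / (z \<bullet> z)"
        by (simp add: sum.distrib sum_subtractf flip: sum_divide_distrib sum_distrib_right euclidean_inner)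
      also have "\<dots> = x \<bullet> e"
        using x(1) z by (simp add: horizontal_iff ijk_skew)
      finally show ?thesis .
    qed
    then show ?thesis by (simp add: euclidean_representation flip: x_def)
  qed
  moreover have "smooth_on (-{0}) (\<lambda>z. \<Sum>e\<in>Basis. (\<Sum>b\<in>Basis. (z \<bullet> b) * X (hopf z) (coef b e)) *\<^sub>R e)"
  proof (intro smooth_on_sum smooth_on_scaleR smooth_on_mult smooth_on_inner smooth_on_ident smooth_on_const open_nonzero)
    show "smooth_on (-{0}) (\<lambda>z. X (hopf z) (coef b e))" for b e
      using assms coef_smooth[of b e] unfolding vfields_def smooth_cp3_def by blast
  qed
  ultimately have "smooth_on (-{0}) (field_lift X)"
    using smooth_on_cong[OF open_nonzero, of "field_lift X"] by simp
  then show "horizontal_field (field_lift X)"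
    using * hom by (intro horizontal_fieldI) blast+
qed

lemma vfield_eqI: "(\<And>z. z \<noteq> 0 \<Longrightarrow> X (hopf z) = Y (hopf z)) \<Longrightarrow> X = Y"
  by (rule ext) (metis cp3_exhaust)

section \<open>Lifted operations preserve smooth equivariant horizontal fields\<close>

lemma smooth_gam:
  assumes "smooth_on (-{0}) f" "smooth_on (-{0}) g"
  shows "smooth_on (-{0}) (\<lambda>z. gam z (f z) (g z))"
  unfolding gam_def
  by (intro smooth_on_add smooth_on_scaleR smooth_on_divide smooth_on_inner smooth_on_ident assms open_nonzero
      smooth_on_bounded_linear[OF bounded_linear_jmult] smooth_on_bounded_linear[OF bounded_linear_kmult]) auto

lemma smooth_vproj: "smooth_on (-{0}) f \<Longrightarrow> smooth_on (-{0}) (\<lambda>z. vproj z (f z))"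
  unfolding vproj_def by (intro smooth_gam smooth_on_ident open_nonzero)

lemma smooth_hproj:
  assumes "smooth_on (-{0}) f"
  shows "smooth_on (-{0}) (\<lambda>z. hproj z (f z))"
  unfolding hproj_def
  by (intro smooth_on_diff smooth_on_scaleR smooth_on_divide smooth_on_inner smooth_on_ident assms open_nonzero
      smooth_on_bounded_linear[OF bounded_linear_imult]) auto

lemma smooth_J_lift: "smooth_on (-{0}) f \<Longrightarrow> smooth_on (-{0}) (\<lambda>z. J_lift z (f z))"
  unfolding J_lift_def
  by (intro smooth_on_bounded_linear[OF bounded_linear_imult] smooth_on_diff smooth_on_scaleR smooth_on_const
      smooth_vproj open_nonzero)

lemma smooth_g_lift:
  assumes "smooth_on (-{0}) f" "smooth_on (-{0}) g"
  shows "smooth_on (-{0}) (\<lambda>z. g_lift a z (f z) (g z))"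
  unfolding g_lift_def
  by (intro smooth_on_divide smooth_on_add smooth_on_mult smooth_on_const smooth_on_inner smooth_on_ident
      smooth_vproj assms open_nonzero) auto

lemma horizontal_field_add:
  "horizontal_field \<xi> \<Longrightarrow> horizontal_field \<eta> \<Longrightarrow> horizontal_field (\<lambda>z. \<xi> z + \<eta> z)"
  by (rule horizontal_fieldI) (simp_all add: horizontal_fieldD smooth_on_add horizontal_add)

lemma horizontal_field_diff:
  "horizontal_field \<xi> \<Longrightarrow> horizontal_field \<eta> \<Longrightarrow> horizontal_field (\<lambda>z. \<xi> z - \<eta> z)"
  by (rule horizontal_fieldI) (simp_all add: horizontal_fieldD smooth_on_diff horizontal_diff)

lemma horizontal_field_scaleR:
  "h \<in> smooth_cp3 \<Longrightarrow> horizontal_field \<xi> \<Longrightarrow> horizontal_field (\<lambda>z. h (hopf z) *\<^sub>R \<xi> z)"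
  by (rule horizontal_fieldI)
    (simp_all add: horizontal_fieldD smooth_on_scaleR horizontal_scaleR hopf_cmult smooth_cp3_def)

lemma horizontal_field_J_lift:
  "horizontal_field \<xi> \<Longrightarrow> horizontal_field (\<lambda>z. J_lift z (\<xi> z))"
  by (rule horizontal_fieldI) (simp_all add: horizontal_fieldD smooth_J_lift J_lift_horizontal J_lift_cmult)

lemma horizontal_field_has_derivative:
  "horizontal_field \<xi> \<Longrightarrow> z \<noteq> 0 \<Longrightarrow> (\<xi> has_derivative frechet_derivative \<xi> (at z)) (at z)"
  by (intro smooth_on_has_derivative[of "-{0}"]) (auto simp: horizontal_fieldD)

text \<open>Differentiate \<xi>(c z) = c \<xi>(z) on both sides.\<close>

lemma frechet_derivative_cmult:
  assumes "horizontal_field \<xi>" "z \<noteq> 0" "c \<noteq> 0"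
  shows "frechet_derivative \<xi> (at (cmult c z)) (cmult c v) = cmult c (frechet_derivative \<xi> (at z) v)"
proof -
  have "(cmult c has_derivative cmult c) (at z)"
    by (rule linear_imp_has_derivative[OF linear_cmult])
  moreover have "(\<xi> has_derivative frechet_derivative \<xi> (at (cmult c z))) (at (cmult c z))"
    using assms by (intro horizontal_field_has_derivative) auto
  ultimately have "(\<xi> \<circ> cmult c has_derivative frechet_derivative \<xi> (at (cmult c z)) \<circ> cmult c) (at z)"
    by (rule diff_chain_at)
  moreover have "(\<xi> \<circ> cmult c has_derivative cmult c \<circ> frechet_derivative \<xi> (at z)) (at z)"
  proof (rule has_derivative_transform_within_open[OF _ open_nonzero])
    show "((\<lambda>z. cmult c (\<xi> z)) has_derivative cmult c \<circ> frechet_derivative \<xi> (at z)) (at z)"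
      unfolding o_def using bounded_linear.has_derivative[OF bounded_linear_cmult horizontal_field_has_derivative] assms
      by blast
  qed (use assms horizontal_fieldD(3) in auto)
  ultimately have "frechet_derivative \<xi> (at (cmult c z)) \<circ> cmult c = cmult c \<circ> frechet_derivative \<xi> (at z)"
    by (rule has_derivative_unique)
  from fun_cong[OF this, of v] show ?thesis by simp
qed

lemma horizontal_field_conn_lift:
  assumes "horizontal_field \<xi>" "horizontal_field \<eta>"
  shows "horizontal_field (\<lambda>z. conn_lift a z (\<xi> z) (\<eta> z) (frechet_derivative \<eta> (at z) (\<xi> z)))"
proof -
  note s = horizontal_fieldD(1)[OF assms(1)] horizontal_fieldD(1)[OF assms(2)]
  have "smooth_on (-{0}) (\<lambda>z. conn_lift a z (\<xi> z) (\<eta> z) (frechet_derivative \<eta> (at z) (\<xi> z)))"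
    unfolding conn_lift_def
    by (intro smooth_on_add smooth_on_scaleR smooth_on_const smooth_on_diff smooth_hproj smooth_gam smooth_vproj
        smooth_on_frechet_derivative s open_nonzero)
  then show ?thesis
    using assms
    by (intro horizontal_fieldI) (simp_all add: horizontal_fieldD conn_lift_horizontal frechet_derivative_cmult conn_lift_cmult)
qed

text \<open>Exhibiting a horizontal field that projects to X settles both smoothness of X and its
  lift; the algebraic operations on fields below are all treated this way.\<close>

lemma vfield_of_lift:
  assumes "horizontal_field \<xi>" "\<And>z. z \<noteq> 0 \<Longrightarrow> X (hopf z) = dhopf z (\<xi> z)"
  shows "X \<in> vfields smooth_cp3" "z \<noteq> 0 \<Longrightarrow> field_lift X z = \<xi> z"
proof -
  have "X = descend \<xi>"
    by (rule vfield_eqI) (simp add: assms descend_hopf)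
  then show "X \<in> vfields smooth_cp3" "z \<noteq> 0 \<Longrightarrow> field_lift X z = \<xi> z"
    using descend_vfields field_lift_descend assms(1) by auto
qed

lemma
  assumes "X \<in> vfields smooth_cp3" "Y \<in> vfields smooth_cp3"
  shows vfields_add: "X + Y \<in> vfields smooth_cp3"
    and field_lift_add: "z \<noteq> 0 \<Longrightarrow> field_lift (X + Y) z = field_lift X z + field_lift Y z"
  by (rule vfield_of_lift[of "\<lambda>z. field_lift X z + field_lift Y z"];
      simp add: horizontal_field_add horizontal_field_lift assms dhopf_add vfield_hopf)+

lemma
  assumes "X \<in> vfields smooth_cp3" "Y \<in> vfields smooth_cp3"
  shows vfields_diff: "X - Y \<in> vfields smooth_cp3"
    and field_lift_diff: "z \<noteq> 0 \<Longrightarrow> field_lift (X - Y) z = field_lift X z - field_lift Y z"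
  by (rule vfield_of_lift[of "\<lambda>z. field_lift X z - field_lift Y z"];
      simp add: horizontal_field_diff horizontal_field_lift assms dhopf_diff vfield_hopf)+

lemma
  assumes "X \<in> vfields smooth_cp3" "h \<in> smooth_cp3"
  shows vfields_vscale: "vscale h X \<in> vfields smooth_cp3"
    and field_lift_vscale: "z \<noteq> 0 \<Longrightarrow> field_lift (vscale h X) z = h (hopf z) *\<^sub>R field_lift X z"
  by (rule vfield_of_lift[of "\<lambda>z. h (hopf z) *\<^sub>R field_lift X z"];
      simp add: horizontal_field_scaleR horizontal_field_lift assms dhopf_scaleR vfield_hopf vscale_def)+

lemma
  assumes "X \<in> vfields smooth_cp3"
  shows vfields_app_endo: "app_endo J_cp3 X \<in> vfields smooth_cp3"
    and field_lift_app_endo: "z \<noteq> 0 \<Longrightarrow> field_lift (app_endo J_cp3 X) z = J_lift z (field_lift X z)"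
  by (rule vfield_of_lift[of "\<lambda>z. J_lift z (field_lift X z)"];
      simp add: horizontal_field_J_lift horizontal_field_lift assms J_cp3_hopf vfield_hopf app_endo_def
       horizontal_fieldD)+

lemmas field_lift_horizontal = horizontal_fieldD(2)[OF horizontal_field_lift]

lemma inner_field_hopf:
  "X \<in> vfields smooth_cp3 \<Longrightarrow> Y \<in> vfields smooth_cp3 \<Longrightarrow> z \<noteq> 0 \<Longrightarrow>
    inner_field (g_cp3 a) X Y (hopf z) = g_lift a z (field_lift X z) (field_lift Y z)"
  by (simp add: inner_field_def vfield_hopf g_cp3_hopf field_lift_horizontal)

lemma inner_field_smooth:
  assumes "X \<in> vfields smooth_cp3" "Y \<in> vfields smooth_cp3"
  shows "inner_field (g_cp3 a) X Y \<in> smooth_cp3"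
proof -
  have "smooth_on (-{0}) (\<lambda>z. g_lift a z (field_lift X z) (field_lift Y z))"
    using assms by (intro smooth_g_lift horizontal_fieldD(1) horizontal_field_lift)
  then show ?thesis
    using smooth_on_cong[OF open_nonzero, of "\<lambda>z. inner_field (g_cp3 a) X Y (hopf z)"] inner_field_hopf[OF assms]
    by (simp add: smooth_cp3_def)
qed

lemma almost_hermitian_cp3:
  assumes "a > 0"
  shows "almost_hermitian smooth_cp3 (g_cp3 a) J_cp3"
proof -
  note lin = dhopf_add[symmetric] dhopf_scaleR[symmetric] dhopf_minus[symmetric]
  have R: "g_cp3 a p u v = g_cp3 a p v u \<and> g_cp3 a p (u + v) w = g_cp3 a p u w + g_cp3 a p v w \<and>
        g_cp3 a p (tscale c u) w = c * g_cp3 a p u w \<and> (u \<noteq> 0 \<longrightarrow> g_cp3 a p u u > 0)"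
    and C: "J_cp3 p u \<in> tangent_space smooth_cp3 p \<and> J_cp3 p (u + v) = J_cp3 p u + J_cp3 p v \<and>
        J_cp3 p (tscale c u) = tscale c (J_cp3 p u) \<and> J_cp3 p (J_cp3 p u) = - u"
    and H: "g_cp3 a p (J_cp3 p u) (J_cp3 p v) = g_cp3 a p u v"
    if uvw: "u \<in> tangent_space smooth_cp3 p" "v \<in> tangent_space smooth_cp3 p" "w \<in> tangent_space smooth_cp3 p"
    for p u v w c
  proof -
    obtain z where z: "z \<noteq> 0" "p = hopf z" using cp3_exhaust .
    obtain u' v' w' where h: "u' \<in> horizontal z" "v' \<in> horizontal z" "w' \<in> horizontal z"
      and eq: "u = dhopf z u'" "v = dhopf z v'" "w = dhopf z w'"
      using uvw unfolding z(2) tangent_space_hopf[OF z(1)] by blast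
    show "g_cp3 a p u v = g_cp3 a p v u \<and> g_cp3 a p (u + v) w = g_cp3 a p u w + g_cp3 a p v w \<and>
        g_cp3 a p (tscale c u) w = c * g_cp3 a p u w \<and> (u \<noteq> 0 \<longrightarrow> g_cp3 a p u u > 0)"
      using z(1) h assms unfolding eq z(2)
      by (simp add: lin g_cp3_hopf horizontal_add horizontal_scaleR g_lift_linear g_lift_sym[of a z v'])
        (metis dhopf_0 g_lift_pos)
    show "J_cp3 p u \<in> tangent_space smooth_cp3 p \<and> J_cp3 p (u + v) = J_cp3 p u + J_cp3 p v \<and>
        J_cp3 p (tscale c u) = tscale c (J_cp3 p u) \<and> J_cp3 p (J_cp3 p u) = - u"
      using z(1) h unfolding eq z(2)
      by (simp add: lin J_cp3_hopf horizontal_add horizontal_scaleR J_lift_linear J_lift_horizontal J_lift_J_lift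
          tangent_space_hopf)
    show "g_cp3 a p (J_cp3 p u) (J_cp3 p v) = g_cp3 a p u v"
      using z(1) h unfolding eq z(2)
      by (simp add: J_cp3_hopf g_cp3_hopf J_lift_horizontal g_lift_J_lift)
  qed
  show ?thesis
    unfolding almost_hermitian_def riemannian_metric_def almost_complex_structure_def
    using R C H inner_field_smooth vfields_app_endo by blast
qed

lemma frechet_derivative_eqI:
  assumes "(g has_derivative g') (at z)" "z \<noteq> (0::c4)" "\<And>y. y \<noteq> 0 \<Longrightarrow> f y = g y"
  shows "frechet_derivative f (at z) = g'"
proof -
  have "(f has_derivative g') (at z)"
    by (rule has_derivative_transform_within_open[OF assms(1) open_nonzero]) (use assms in auto)
  then show ?thesis by (rule frechet_derivative_at[symmetric])
qed

text \<open>Product rule for differentiating f along a moving direction, obtained from the basis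
  expansion of \<eta>. It separates the second derivative of f from the derivative of \<eta>, as
  needed for the Lie bracket.\<close>

lemma has_derivative_frechet_derivative:
  fixes f :: "'a::euclidean_space \<Rightarrow> real" and \<eta> :: "'a \<Rightarrow> 'a"
  assumes S: "open S" "x \<in> S" and f: "smooth_on S f" and \<eta>: "(\<eta> has_derivative \<eta>') (at x)"
  shows "((\<lambda>y. frechet_derivative f (at y) (\<eta> y)) has_derivative
    (\<lambda>v. frechet_derivative (\<lambda>y. frechet_derivative f (at y) (\<eta> x)) (at x) v + frechet_derivative f (at x) (\<eta>' v))) (at x)"
proof -
  have ex: "frechet_derivative f (at y) w = (\<Sum>b\<in>Basis. (w \<bullet> b) * frechet_derivative f (at y) b)" if "y \<in> S" for y w
  proof -
    have lin: "linear (frechet_derivative f (at y))"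
      using smooth_on_has_derivative[OF f that] has_derivative_linear by blast
    show ?thesis
      using linear_sum[OF lin, of "\<lambda>b. (w \<bullet> b) *\<^sub>R b" Basis]
      by (simp add: linear_cmul[OF lin] euclidean_representation)
  qed
  define D where "D b v = frechet_derivative (\<lambda>y. frechet_derivative f (at y) b) (at x) v" for b v
  have D: "((\<lambda>y. frechet_derivative f (at y) b) has_derivative D b) (at x)" for b
    using smooth_on_has_derivative[OF smooth_on_frechet_derivative_const[OF f] S(2)]
    by (simp add: D_def[abs_def])
  have 1: "((\<lambda>y. \<Sum>b\<in>Basis. (\<eta> y \<bullet> b) * frechet_derivative f (at y) b) has_derivative
    (\<lambda>v. \<Sum>b\<in>Basis. (\<eta> x \<bullet> b) * D b v + (\<eta>' v \<bullet> b) * frechet_derivative f (at x) b)) (at x)"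
    by (intro has_derivative_sum has_derivative_mult has_derivative_inner_left \<eta> D)
  have 2: "((\<lambda>y. \<Sum>b\<in>Basis. (\<eta> x \<bullet> b) * frechet_derivative f (at y) b) has_derivative
    (\<lambda>v. \<Sum>b\<in>Basis. (\<eta> x \<bullet> b) * D b v)) (at x)"
    by (intro has_derivative_sum has_derivative_mult_right D)
  have "((\<lambda>y. frechet_derivative f (at y) (\<eta> x)) has_derivative
    (\<lambda>v. \<Sum>b\<in>Basis. (\<eta> x \<bullet> b) * D b v)) (at x)"
    by (rule has_derivative_transform_within_open[OF 2 S]) (rule ex[symmetric])
  then have 3: "frechet_derivative (\<lambda>y. frechet_derivative f (at y) (\<eta> x)) (at x) = (\<lambda>v. \<Sum>b\<in>Basis. (\<eta> x \<bullet> b) * D b v)"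
    by (rule frechet_derivative_at[symmetric])
  have "((\<lambda>y. frechet_derivative f (at y) (\<eta> y)) has_derivative
    (\<lambda>v. \<Sum>b\<in>Basis. (\<eta> x \<bullet> b) * D b v + (\<eta>' v \<bullet> b) * frechet_derivative f (at x) b)) (at x)"
    by (rule has_derivative_transform_within_open[OF 1 S]) (rule ex[symmetric])
  then show ?thesis
    unfolding 3 sum.distrib ex[OF S(2), of "\<eta>' _", symmetric] .
qed

subsection \<open>The Levi-Civita connection\<close>

definition nabla_lift :: "real \<Rightarrow> cp3 vfield \<Rightarrow> cp3 vfield \<Rightarrow> c4 \<Rightarrow> c4" where
  "nabla_lift a X Y z =
     conn_lift a z (field_lift X z) (field_lift Y z) (frechet_derivative (field_lift Y) (at z) (field_lift X z))"

definition nabla_cp3 :: "real \<Rightarrow> cp3 connection" where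
  "nabla_cp3 a X Y = descend (nabla_lift a X Y)"

lemma
  assumes "X \<in> vfields smooth_cp3" "Y \<in> vfields smooth_cp3"
  shows nabla_cp3_vfields: "nabla_cp3 a X Y \<in> vfields smooth_cp3"
    and nabla_cp3_hopf: "z \<noteq> 0 \<Longrightarrow> nabla_cp3 a X Y (hopf z) = dhopf z (nabla_lift a X Y z)"
proof -
  have "horizontal_field (nabla_lift a X Y)"
    using horizontal_field_conn_lift[OF assms[THEN horizontal_field_lift]]
    by (simp add: nabla_lift_def[abs_def])
  then show "nabla_cp3 a X Y \<in> vfields smooth_cp3"
    "z \<noteq> 0 \<Longrightarrow> nabla_cp3 a X Y (hopf z) = dhopf z (nabla_lift a X Y z)"
    by (auto simp: nabla_cp3_def descend_vfields descend_hopf)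
qed

lemma field_lift_has_derivative:
  "X \<in> vfields smooth_cp3 \<Longrightarrow> z \<noteq> 0 \<Longrightarrow>
    (field_lift X has_derivative frechet_derivative (field_lift X) (at z)) (at z)"
  by (rule horizontal_field_has_derivative[OF horizontal_field_lift])

lemma vfield_apply:
  assumes "X \<in> vfields smooth_cp3" "h \<in> smooth_cp3" "z \<noteq> 0"
  shows "X (hopf z) h = frechet_derivative (\<lambda>z. h (hopf z)) (at z) (field_lift X z)"
  using assms by (simp add: vfield_hopf dhopf_def)

lemma affine_connection_nabla: "affine_connection smooth_cp3 (nabla_cp3 a)"
  unfolding affine_connection_def
proof (intro ballI conjI)
  fix X Y Z h assume *: "X \<in> vfields smooth_cp3" "Y \<in> vfields smooth_cp3" "Z \<in> vfields smooth_cp3" "h \<in> smooth_cp3"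
  note v = * vfields_add[OF *(1,2)] vfields_add[OF *(2,3)] vfields_vscale[OF *(1,4)] vfields_vscale[OF *(2,4)]
  have lin: "linear (frechet_derivative (field_lift W) (at z))" if "W \<in> vfields smooth_cp3" "z \<noteq> 0" for W z
    using has_derivative_linear[OF field_lift_has_derivative[OF that]] .
  show "nabla_cp3 a X Y \<in> vfields smooth_cp3" using *(1,2) by (rule nabla_cp3_vfields)
  show "nabla_cp3 a (X + Y) Z = nabla_cp3 a X Z + nabla_cp3 a Y Z"
  proof (rule vfield_eqI)
    fix z :: c4 assume z: "z \<noteq> 0"
    have "nabla_lift a (X + Y) Z z = nabla_lift a X Z z + nabla_lift a Y Z z"
      using v z by (simp add: nabla_lift_def field_lift_add linear_add[OF lin] conn_lift_def hproj_linear
          gam_linear vproj_linear algebra_simps)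
    then show "nabla_cp3 a (X + Y) Z (hopf z) = (nabla_cp3 a X Z + nabla_cp3 a Y Z) (hopf z)"
      using v z by (simp add: nabla_cp3_hopf dhopf_add)
  qed
  show "nabla_cp3 a (vscale h X) Z = vscale h (nabla_cp3 a X Z)"
  proof (rule vfield_eqI)
    fix z :: c4 assume z: "z \<noteq> 0"
    have "nabla_lift a (vscale h X) Z z = h (hopf z) *\<^sub>R nabla_lift a X Z z"
      using v z by (simp add: nabla_lift_def field_lift_vscale linear_cmul[OF lin] conn_lift_def hproj_linear
          gam_linear vproj_linear algebra_simps)
    then show "nabla_cp3 a (vscale h X) Z (hopf z) = vscale h (nabla_cp3 a X Z) (hopf z)"
      using v z by (simp add: nabla_cp3_hopf dhopf_scaleR vscale_def)
  qed
  show "nabla_cp3 a X (Y + Z) = nabla_cp3 a X Y + nabla_cp3 a X Z"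
  proof (rule vfield_eqI)
    fix z :: c4 assume z: "z \<noteq> 0"
    have "frechet_derivative (field_lift (Y + Z)) (at z) = (\<lambda>v. frechet_derivative (field_lift Y) (at z) v
        + frechet_derivative (field_lift Z) (at z) v)"
      using v z by (intro frechet_derivative_eqI[OF has_derivative_add[OF field_lift_has_derivative field_lift_has_derivative]])
        (auto intro: field_lift_add)
    then have "nabla_lift a X (Y + Z) z = nabla_lift a X Y z + nabla_lift a X Z z"
      using v z by (simp add: nabla_lift_def field_lift_add conn_lift_def hproj_linear
          gam_linear vproj_linear algebra_simps)
    then show "nabla_cp3 a X (Y + Z) (hopf z) = (nabla_cp3 a X Y + nabla_cp3 a X Z) (hopf z)"
      using v z by (simp add: nabla_cp3_hopf dhopf_add)
  qed
  show "nabla_cp3 a X (vscale h Y) = vscale (\<lambda>p. X p h) Y + vscale h (nabla_cp3 a X Y)"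
  proof (rule vfield_eqI)
    fix z :: c4 assume z: "z \<noteq> 0"
    have "frechet_derivative (field_lift (vscale h Y)) (at z) =
      (\<lambda>v. h (hopf z) *\<^sub>R frechet_derivative (field_lift Y) (at z) v + dhopf z v h *\<^sub>R field_lift Y z)"
      by (rule frechet_derivative_eqI[OF has_derivative_scaleR[OF smooth_cp3_has_derivative[OF *(4) z]
            field_lift_has_derivative[OF *(2) z]] z]) (rule field_lift_vscale[OF *(2,4)])
    \<comment> \<open>The derivative of h multiplies the lift of Y, which is horizontal and
      therefore fixed by \<open>hproj\<close>; this produces exactly the Leibniz term.\<close>
    then have "nabla_lift a X (vscale h Y) z = X (hopf z) h *\<^sub>R field_lift Y z + h (hopf z) *\<^sub>R nabla_lift a X Y z"
      using v z by (simp add: nabla_lift_def field_lift_vscale conn_lift_def hproj_linear vfield_hopf[OF *(1)]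
          hproj_id field_lift_horizontal gam_linear vproj_linear algebra_simps)
    then show "nabla_cp3 a X (vscale h Y) (hopf z) = (vscale (\<lambda>p. X p h) Y + vscale h (nabla_cp3 a X Y)) (hopf z)"
      using v z by (simp add: nabla_cp3_hopf dhopf_add dhopf_scaleR vscale_def vfield_hopf[OF *(2)])
  qed
qed

text \<open>In the bracket the second derivatives of the pulled back function cancel by symmetry.
  What remains is the difference of the derivatives of the two lifts, whose vertical part is killed
  by \<open>dhopf\<close>.\<close>

lemma torsion_nabla:
  assumes X: "X \<in> vfields smooth_cp3" and Y: "Y \<in> vfields smooth_cp3"
  shows "nabla_cp3 a X Y - nabla_cp3 a Y X = bracket X Y"
proof (rule vfield_eqI, rule ext)
  fix z :: c4 and f assume z: "z \<noteq> 0"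
  let ?x = "field_lift X z" and ?y = "field_lift Y z"
  let ?dX = "frechet_derivative (field_lift X) (at z)" and ?dY = "frechet_derivative (field_lift Y) (at z)"
  have eq: "(nabla_cp3 a X Y - nabla_cp3 a Y X) (hopf z) = dhopf z (?dY ?x - ?dX ?y)"
    using X Y z by (simp add: nabla_cp3_hopf nabla_lift_def conn_lift_torsion dhopf_hproj flip: dhopf_diff)
  have "dhopf z (?dY ?x - ?dX ?y) f = bracket X Y (hopf z) f"
  proof (cases "f \<in> smooth_cp3")
    case True
    let ?f = "\<lambda>z. f (hopf z)"
    let ?f2 = "\<lambda>v w. frechet_derivative (\<lambda>y. frechet_derivative ?f (at y) v) (at z) w"
    have sf: "smooth_on (-{0}) ?f" using True by (simp add: smooth_cp3_def)
    have *: "U (hopf z) (\<lambda>q. V q f) = ?f2 (field_lift V z) (field_lift U z)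
      + dhopf z (frechet_derivative (field_lift V) (at z) (field_lift U z)) f"
      if U: "U \<in> vfields smooth_cp3" and V: "V \<in> vfields smooth_cp3" for U V
    proof -
      have Vf: "(\<lambda>q. V q f) \<in> smooth_cp3" using V True unfolding vfields_def by blast
      have "frechet_derivative (\<lambda>z. V (hopf z) f) (at z) = (\<lambda>v. ?f2 (field_lift V z) v
          + frechet_derivative ?f (at z) (frechet_derivative (field_lift V) (at z) v))"
      proof (rule frechet_derivative_eqI[OF _ z])
        show "((\<lambda>y. frechet_derivative ?f (at y) (field_lift V y)) has_derivative
          (\<lambda>v. ?f2 (field_lift V z) v + frechet_derivative ?f (at z) (frechet_derivative (field_lift V) (at z) v))) (at z)"
          using z by (intro has_derivative_frechet_derivative[OF open_nonzero _ sf field_lift_has_derivative[OF V z]]) simp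
      qed (rule vfield_apply[OF V True])
      then show ?thesis
        by (simp add: vfield_apply[OF U Vf z] dhopf_def True)
    qed
    have "?f2 ?x ?y = ?f2 ?y ?x"
      using z by (intro frechet_derivative_commute[OF open_nonzero _ sf]) simp
    then show ?thesis
      by (simp add: bracket_def *[OF X Y] *[OF Y X] dhopf_diff z)
  next
    case False
    \<comment> \<open>Tangent vectors are total operators, so equality is also due outside
      \<open>smooth_cp3\<close>: there every field gives 0, and the bracket differentiates the zero
      function.\<close>
    have 0: "V (hopf y) f = 0" if "V \<in> vfields smooth_cp3" "y \<noteq> 0" for V y
      using that False by (simp add: vfield_hopf dhopf_not_smooth)
    have const0: "(\<lambda>p. V p f) = (\<lambda>p. 0)" if "V \<in> vfields smooth_cp3" for V
    proof
      fix p
      obtain y where "y \<noteq> 0" "p = hopf y" using cp3_exhaust .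
      then show "V p f = 0" using 0[OF that] by simp
    qed
    have "V (hopf z) (\<lambda>q. 0) = 0" if "V \<in> vfields smooth_cp3" for V
      using that z by (simp add: vfield_hopf dhopf_def)
    from this[OF X] this[OF Y] show ?thesis
      using False by (simp add: bracket_def dhopf_not_smooth const0[OF X] const0[OF Y])
  qed
  then show "(nabla_cp3 a X Y - nabla_cp3 a Y X) (hopf z) f = bracket X Y (hopf z) f"
    unfolding eq .
qed

text \<open>The lifted inner product is differentiated as an explicit function on C^4; along a
  horizontal vector the derivatives of the denominators vanish and \<open>conn_lift_metric\<close>
  applies.\<close>

lemma metric_nabla:
  assumes "a > 0" and X: "X \<in> vfields smooth_cp3" and Y: "Y \<in> vfields smooth_cp3" and Z: "Z \<in> vfields smooth_cp3"
  shows "X p (inner_field (g_cp3 a) Y Z) = g_cp3 a p (nabla_cp3 a X Y p) (Z p) + g_cp3 a p (Y p) (nabla_cp3 a X Z p)"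
proof -
  obtain z where z: "z \<noteq> 0" "p = hopf z" using cp3_exhaust .
  define v e f where "v = field_lift X z" and "e = field_lift Y z" and "f = field_lift Z z"
  define E' F' where "E' = frechet_derivative (field_lift Y) (at z)" and "F' = frechet_derivative (field_lift Z) (at z)"
  have h: "v \<in> horizontal z" "e \<in> horizontal z" "f \<in> horizontal z"
    using X Y Z z by (simp_all add: v_def e_def f_def field_lift_horizontal)
  have dE: "(field_lift Y has_derivative E') (at z)" and dF: "(field_lift Z has_derivative F') (at z)"
    unfolding E'_def F'_def using Y Z z field_lift_has_derivative by blast+
  \<comment> \<open>By \<open>inner_vproj\<close>, M y / |y|^2 is the term of the metric that
    involves \<open>vproj\<close>; the outer 1/|y|^2 makes a second quotient.\<close>
  define M where "M = (\<lambda>y. (field_lift Y y \<bullet> jmult y) * (field_lift Z y \<bullet> jmult y)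
      + (field_lift Y y \<bullet> kmult y) * (field_lift Z y \<bullet> kmult y))"
  define M' where "M' = (\<lambda>u. (E' u \<bullet> jmult z + e \<bullet> jmult u) * (f \<bullet> jmult z) + (e \<bullet> jmult z) * (F' u \<bullet> jmult z + f \<bullet> jmult u)
       + (E' u \<bullet> kmult z + e \<bullet> kmult u) * (f \<bullet> kmult z) + (e \<bullet> kmult z) * (F' u \<bullet> kmult z + f \<bullet> kmult u))"
  have "(M has_derivative M') (at z)"
    unfolding M_def M'_def e_def f_def
    by (auto intro!: derivative_eq_intros dE dF bounded_linear.has_derivative[OF bounded_linear_jmult]
        bounded_linear.has_derivative[OF bounded_linear_kmult] simp: algebra_simps)
  note dM = has_derivative_div_norm[OF this z(1)]
  have "((\<lambda>y. a * (field_lift Y y \<bullet> field_lift Z y) + (1 - a) * (M y / (y \<bullet> y))) has_derivative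
     (\<lambda>u. a * (E' u \<bullet> f + e \<bullet> F' u) + (1 - a) * ((M' u - M z / (z \<bullet> z) * (2 * (u \<bullet> z))) / (z \<bullet> z)))) (at z)"
    unfolding e_def f_def
    by (rule has_derivative_eq_rhs[OF has_derivative_add[OF has_derivative_mult_right[OF has_derivative_inner[OF dE dF]]
          has_derivative_mult_right[OF dM]]])
      (simp add: add.commute)
  note dN = has_derivative_div_norm[OF this z(1)]
  have "frechet_derivative (\<lambda>z. inner_field (g_cp3 a) Y Z (hopf z)) (at z) = (\<lambda>u.
     (a * (E' u \<bullet> f + e \<bullet> F' u) + (1 - a) * ((M' u - M z / (z \<bullet> z) * (2 * (u \<bullet> z))) / (z \<bullet> z))
      - (a * (field_lift Y z \<bullet> field_lift Z z) + (1 - a) * (M z / (z \<bullet> z))) / (z \<bullet> z) * (2 * (u \<bullet> z))) / (z \<bullet> z))"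
    by (rule frechet_derivative_eqI[OF dN z(1)]) (simp add: inner_field_hopf[OF Y Z] g_lift_def inner_vproj M_def)
  then have "X p (inner_field (g_cp3 a) Y Z) = (a * (E' v \<bullet> f + e \<bullet> F' v) + (1 - a) * (M' v / (z \<bullet> z))) / (z \<bullet> z)"
    using h(1) by (simp add: z vfield_apply[OF X inner_field_smooth[OF Y Z] z(1)] horizontal_iff flip: v_def)
  also have "\<dots> = g_lift a z (conn_lift a z v e (E' v)) f + g_lift a z e (conn_lift a z v f (F' v))"
    unfolding conn_lift_metric[OF assms(1) z(1) h] M'_def ..
  also have "\<dots> = g_cp3 a p (nabla_cp3 a X Y p) (Z p) + g_cp3 a p (Y p) (nabla_cp3 a X Z p)"
    using X Y Z z(1) h conn_lift_horizontal[OF z(1)] unfolding z(2)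
    by (simp add: nabla_cp3_hopf vfield_hopf nabla_lift_def g_cp3_hopf field_lift_horizontal flip: v_def e_def f_def E'_def F'_def)
  finally show ?thesis .
qed

lemma levi_civita_nabla: "a > 0 \<Longrightarrow> is_levi_civita smooth_cp3 (g_cp3 a) (nabla_cp3 a)"
  by (simp add: is_levi_civita_def affine_connection_nabla torsion_nabla metric_nabla)

text \<open>The difference of two Levi-Civita connections, contracted with the metric, is symmetric in the
  first two and antisymmetric in the last two arguments, hence zero.\<close>

lemma levi_civita_unique:
  assumes a: "a > 0" and D: "is_levi_civita smooth_cp3 (g_cp3 a) D" and E: "is_levi_civita smooth_cp3 (g_cp3 a) E"
    and X: "X \<in> vfields smooth_cp3" and Y: "Y \<in> vfields smooth_cp3"
  shows "D X Y = E X Y"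
proof
  fix p
  define S where "S U V = D U V - E U V" for U V
  have DE: "D U V \<in> vfields smooth_cp3" "E U V \<in> vfields smooth_cp3"
    if "U \<in> vfields smooth_cp3" "V \<in> vfields smooth_cp3" for U V
  proof -
    \<comment> \<open>\<open>affine_connection\<close> binds a third field and a smooth function as
      well; the fields at hand and some \<open>coef\<close> serve as witnesses.\<close>
    have "C U V \<in> vfields smooth_cp3" if "is_levi_civita smooth_cp3 (g_cp3 a) C" for C
      using that[unfolded is_levi_civita_def affine_connection_def, THEN conjunct1, THEN bspec, THEN bspec, THEN bspec, THEN bspec]
        \<open>U \<in> _\<close> \<open>V \<in> _\<close> coef_smooth by blast
    then show "D U V \<in> vfields smooth_cp3" "E U V \<in> vfields smooth_cp3" using D E by blast+
  qed
  have S: "S U V \<in> vfields smooth_cp3" if "U \<in> vfields smooth_cp3" "V \<in> vfields smooth_cp3" for U V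
    unfolding S_def using DE[OF that] by (rule vfields_diff)
  have sym: "S U V = S V U" if "U \<in> vfields smooth_cp3" "V \<in> vfields smooth_cp3" for U V
  proof -
    have "D U V - D V U = E U V - E V U"
      using D[unfolded is_levi_civita_def, THEN conjunct2, THEN conjunct1, THEN bspec, THEN bspec, OF that]
        E[unfolded is_levi_civita_def, THEN conjunct2, THEN conjunct1, THEN bspec, THEN bspec, OF that] by simp
    then show ?thesis by (simp add: S_def algebra_simps)
  qed
  have g: "inner_field (g_cp3 a) (U - V) W p = inner_field (g_cp3 a) U W p - inner_field (g_cp3 a) V W p"
    "inner_field (g_cp3 a) U W p = inner_field (g_cp3 a) W U p"
    if "U \<in> vfields smooth_cp3" "V \<in> vfields smooth_cp3" "W \<in> vfields smooth_cp3" for U V W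
  proof -
    obtain z where z: "z \<noteq> 0" "p = hopf z" using cp3_exhaust .
    have "g_lift a z (u - v) w = g_lift a z u w - g_lift a z v w" for u v w
      using g_lift_linear(1)[of a z "u - v" v w] by simp
    then show "inner_field (g_cp3 a) (U - V) W p = inner_field (g_cp3 a) U W p - inner_field (g_cp3 a) V W p"
      "inner_field (g_cp3 a) U W p = inner_field (g_cp3 a) W U p"
      using that z by (auto simp: inner_field_hopf vfields_diff field_lift_diff g_lift_sym)
  qed
  have anti: "inner_field (g_cp3 a) (S U V) W p = - inner_field (g_cp3 a) (S U W) V p"
    if "U \<in> vfields smooth_cp3" "V \<in> vfields smooth_cp3" "W \<in> vfields smooth_cp3" for U V W
  proof -
    have "inner_field (g_cp3 a) (C U V) W p + inner_field (g_cp3 a) V (C U W) p = U p (inner_field (g_cp3 a) V W)"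
      if C: "is_levi_civita smooth_cp3 (g_cp3 a) C" for C
      using C[unfolded is_levi_civita_def, THEN conjunct2, THEN conjunct2, THEN bspec, THEN bspec, THEN bspec,
          OF \<open>U \<in> _\<close> \<open>V \<in> _\<close> \<open>W \<in> _\<close>] by (simp add: inner_field_def)
    from this[OF D] this[OF E] show ?thesis
      using that DE by (simp add: S_def g(1) g(2)[of V])
  qed
  have "inner_field (g_cp3 a) (S X Y) W p = 0" if W: "W \<in> vfields smooth_cp3" for W
    using anti[OF X Y W] anti[OF W X Y] anti[OF Y W X] sym[OF X Y] sym[OF Y W] sym[OF W X] by simp
  \<comment> \<open>Testing against the difference itself turns the vanishing into positive
    definiteness.\<close>
  from this[OF S[OF X Y]] have 0: "inner_field (g_cp3 a) (S X Y) (S X Y) p = 0" .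
  obtain z where z: "z \<noteq> 0" "p = hopf z" using cp3_exhaust .
  have "field_lift (S X Y) z = 0"
  proof (rule ccontr)
    assume "field_lift (S X Y) z \<noteq> 0"
    from g_lift_pos[OF a z(1) this] show False
      using 0 S[OF X Y] z by (simp add: inner_field_hopf)
  qed
  then have "S X Y p = 0"
    unfolding z(2) vfield_hopf[OF S[OF X Y] z(1)] using dhopf_0[OF z(1)] by metis
  then show "D X Y p = E X Y p" by (simp add: S_def)
qed

text \<open>Existence makes the chosen connection a Levi-Civita connection, and uniqueness then
  fixes its values on smooth fields.\<close>

lemma levi_civita_eq:
  assumes "a > 0" "X \<in> vfields smooth_cp3" "Y \<in> vfields smooth_cp3"
  shows "levi_civita smooth_cp3 (g_cp3 a) X Y = nabla_cp3 a X Y"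
proof -
  have "is_levi_civita smooth_cp3 (g_cp3 a) (levi_civita smooth_cp3 (g_cp3 a))"
    unfolding levi_civita_def using levi_civita_nabla[OF assms(1)]
    by (rule someI[where P = "is_levi_civita smooth_cp3 (g_cp3 a)"])
  then show ?thesis using levi_civita_unique[OF assms(1)] levi_civita_nabla[OF assms(1)] assms by blast
qed

section \<open>The covariant derivative of \<open>J_cp3\<close>\<close>

text \<open>In \<open>vproj z e\<close>, differentiating e gives the \<open>vproj\<close> term,
  differentiating jz, kz inside the inner products gives \<open>bet\<close>, and differentiating the
  outer jz, kz gives \<open>gam\<close>; |z|^2 is stationary along horizontal v.\<close>

lemma J_lift_has_derivative:
  assumes "(\<eta> has_derivative \<eta>') (at z)" "z \<noteq> 0" "v \<in> horizontal z"
  shows "frechet_derivative (\<lambda>y. J_lift y (\<eta> y)) (at z) v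
    = imult (\<eta>' v - 2 *\<^sub>R (bet z v (\<eta> z) + vproj z (\<eta>' v) + gam z (\<eta> z) v))"
proof -
  note jk = bounded_linear.has_derivative[OF bounded_linear_imult] bounded_linear.has_derivative[OF bounded_linear_jmult]
    bounded_linear.has_derivative[OF bounded_linear_kmult]
  have "((\<lambda>y. \<eta> y \<bullet> jmult y) has_derivative (\<lambda>v. \<eta> z \<bullet> jmult v + \<eta>' v \<bullet> jmult z)) (at z)"
    "((\<lambda>y. \<eta> y \<bullet> kmult y) has_derivative (\<lambda>v. \<eta> z \<bullet> kmult v + \<eta>' v \<bullet> kmult z)) (at z)"
    by (intro has_derivative_inner assms(1) jk has_derivative_ident)+
  note d = this[THEN has_derivative_div_norm[OF _ assms(2)]]
  have "frechet_derivative (\<lambda>y. J_lift y (\<eta> y)) (at z) = (\<lambda>v. imult (\<eta>' v - 2 *\<^sub>R (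
      ((\<eta> z \<bullet> jmult z / (z \<bullet> z)) *\<^sub>R jmult v
       + ((\<eta> z \<bullet> jmult v + \<eta>' v \<bullet> jmult z - \<eta> z \<bullet> jmult z / (z \<bullet> z) * (2 * (v \<bullet> z))) / (z \<bullet> z)) *\<^sub>R jmult z)
     + ((\<eta> z \<bullet> kmult z / (z \<bullet> z)) *\<^sub>R kmult v
       + ((\<eta> z \<bullet> kmult v + \<eta>' v \<bullet> kmult z - \<eta> z \<bullet> kmult z / (z \<bullet> z) * (2 * (v \<bullet> z))) / (z \<bullet> z)) *\<^sub>R kmult z))))"
    unfolding J_lift_def vproj_def gam_def
    by (rule frechet_derivative_at[symmetric])
      (intro jk has_derivative_diff has_derivative_scaleR_right has_derivative_add has_derivative_scaleR assms(1) d
        has_derivative_ident)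
  then show ?thesis
    using assms(3) by (simp add: horizontal_iff bet_def vproj_def gam_def add_divide_distrib scaleR_add_left algebra_simps)
qed

lemma nabla_J_hopf:
  assumes "a > 0" "z \<noteq> 0" "X \<in> vfields smooth_cp3" "Y \<in> vfields smooth_cp3"
  shows "nabla_J smooth_cp3 (g_cp3 a) J_cp3 X Y (hopf z) = dhopf z (nabla_J_lift a z (field_lift X z) (field_lift Y z))"
proof -
  have h: "field_lift X z \<in> horizontal z" "field_lift Y z \<in> horizontal z"
    using assms by (simp_all add: field_lift_horizontal)
  define dY where "dY = frechet_derivative (field_lift Y) (at z)"
  have dY: "(field_lift Y has_derivative dY) (at z)"
    unfolding dY_def using assms(4,2) by (rule field_lift_has_derivative)
  have "((\<lambda>y. J_lift y (field_lift Y y)) has_derivative frechet_derivative (\<lambda>y. J_lift y (field_lift Y y)) (at z)) (at z)"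
    using assms by (intro horizontal_field_has_derivative horizontal_field_J_lift horizontal_field_lift)
  then have "frechet_derivative (field_lift (app_endo J_cp3 Y)) (at z) = frechet_derivative (\<lambda>y. J_lift y (field_lift Y y)) (at z)"
    using assms(2) by (rule frechet_derivative_eqI) (rule field_lift_app_endo[OF assms(4)])
  then have "nabla_lift a X (app_endo J_cp3 Y) z - J_lift z (nabla_lift a X Y z)
      = nabla_J_lift a z (field_lift X z) (field_lift Y z)"
    using nabla_J_lift_eq[OF assms(1,2) h, of "dY (field_lift X z)"] assms(2)
    by (simp add: nabla_lift_def field_lift_app_endo[OF assms(4)] J_lift_has_derivative[OF dY assms(2) h(1)] flip: dY_def)
  moreover have "nabla_lift a X Y z \<in> horizontal z"
    unfolding nabla_lift_def using assms(2) h by (rule conn_lift_horizontal)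
  ultimately show ?thesis
    using assms by (simp add: nabla_J_def levi_civita_eq vfields_app_endo nabla_cp3_hopf app_endo_def[of J_cp3 "nabla_cp3 a X Y"]
      J_cp3_hopf flip: dhopf_diff)
qed


text \<open>The field is the horizontal projection of the complex linear map \<open>z \<mapsto> \<langle>z, q\<rangle> v / |q|^2\<close>.\<close>

lemma vfield_extension:
  assumes q: "q \<noteq> 0" and v: "v \<in> horizontal q"
  obtains X where "X \<in> vfields smooth_cp3" "field_lift X q = v"
proof -
  define \<xi> where "\<xi> z = hproj z ((z \<bullet> q / (q \<bullet> q)) *\<^sub>R v + (z \<bullet> imult q / (q \<bullet> q)) *\<^sub>R imult v)" for z
  have "horizontal_field \<xi>"
  proof (rule horizontal_fieldI)
    show "smooth_on (- {0}) \<xi>"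
      unfolding \<xi>_def
      by (intro smooth_hproj smooth_on_add smooth_on_scaleR smooth_on_divide smooth_on_inner smooth_on_const
          smooth_on_ident open_nonzero) (use q in auto)
    show "\<xi> z \<in> horizontal z" if "z \<noteq> 0" for z
      unfolding \<xi>_def using that by (rule hproj_horizontal)
    show "\<xi> (cmult c z) = cmult c (\<xi> z)" if "c \<noteq> 0" for z c
    proof -
      have "(cmult c z \<bullet> q / (q \<bullet> q)) *\<^sub>R v + (cmult c z \<bullet> imult q / (q \<bullet> q)) *\<^sub>R imult v
        = cmult c ((z \<bullet> q / (q \<bullet> q)) *\<^sub>R v + (z \<bullet> imult q / (q \<bullet> q)) *\<^sub>R imult v)"
        by (simp add: cmult_eq inner_simps ijk_skew add_divide_distrib diff_divide_distrib algebra_simps)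
      then show ?thesis unfolding \<xi>_def by (simp only: hproj_cmult[OF that])
    qed
  qed
  moreover have "\<xi> q = v" using q v by (simp add: \<xi>_def hproj_id)
  ultimately show thesis
    using that[of "descend \<xi>"] descend_vfields field_lift_descend q by auto
qed

text \<open>One pair of fields serves both negative claims: v in the second and jq in the first
  distribution. Here \<open>bet\<close> vanishes, since v is orthogonal to the quaternionic line of
  q, and only \<gamma>(jq, v) = jv survives. The derivative is -(2/a) kv, nonzero for every a, and
  its symmetrisation is -2 (2/a - 1) kv.\<close>

lemma nabla_J_example:
  fixes a :: real
  assumes "a > 0"
  obtains X Y z where "X \<in> vfields smooth_cp3" "Y \<in> vfields smooth_cp3" "z \<noteq> 0"
    "nabla_J smooth_cp3 (g_cp3 a) J_cp3 X Y (hopf z) \<noteq> 0"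
    "a \<noteq> 2 \<Longrightarrow> nabla_J smooth_cp3 (g_cp3 a) J_cp3 X Y (hopf z) \<noteq> - nabla_J smooth_cp3 (g_cp3 a) J_cp3 Y X (hopf z)"
proof -
  define q v :: c4 where "q = ((1, 0), (0, 0))" and "v = ((0, 0), (1, 0))"
  have i: "v \<bullet> q = 0" "v \<bullet> imult q = 0" "v \<bullet> jmult q = 0" "v \<bullet> kmult q = 0" "q \<bullet> q = 1"
    by (simp_all add: q_def v_def imult_def jmult_def kmult_def lmult_def qmult_def inner_prod_def)
  have q: "q \<noteq> 0" and nz: "v \<noteq> 0" using i(5) by (auto simp: v_def zero_prod_def)
  have h: "v \<in> horizontal q" "jmult q \<in> horizontal q"
    using i by (simp_all add: horizontal_iff ijk_skew)
  have P: "vproj q v = 0" "vproj q (jmult q) = jmult q"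
    using i by (simp_all add: vproj_def gam_def ijk_skew)
  have G: "gam q (jmult q) v = jmult v"
    using i by (simp add: gam_def ijk_skew)
  obtain X where X: "X \<in> vfields smooth_cp3" "field_lift X q = v" using vfield_extension[OF q h(1)] .
  obtain Y where Y: "Y \<in> vfields smooth_cp3" "field_lift Y q = jmult q" using vfield_extension[OF q h(2)] .
  note XY = X Y
  note N = nabla_J_hopf[OF assms q XY(1,3), unfolded XY(2,4)] nabla_J_hopf[OF assms q XY(3,1), unfolded XY(2,4)]
  have d0: "dhopf q u \<noteq> 0" if "u \<in> horizontal q" "u \<noteq> 0" for u
    using inj_onD[OF dhopf_inj_on[OF q] _ that(1) horizontal_0] that(2) dhopf_0[OF q] by metis
  have hk: "kmult v \<in> horizontal q" using i by (simp add: horizontal_iff ijk_skew)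
  have k: "kmult v \<noteq> 0" using nz by (metis ijk_mult(9) linear_0[OF linear_kmult] neg_equal_0_iff_equal)
  have g0: "gam q y 0 = 0" for y by (simp add: gam_def)
  have 1: "nabla_J_lift a q v (jmult q) = (- 2 / a) *\<^sub>R kmult v"
  proof -
    have "bet q v (jmult q) = 0"
      using i by (simp add: bet_def ijk_skew inner_commute[of q v] ijk_swap(1)[of q v])
    then show ?thesis by (simp add: nabla_J_lift_def P G g0)
  qed
  have 2: "nabla_J_lift a q v (jmult q) + nabla_J_lift a q (jmult q) v = - (2 * (2 / a - 1)) *\<^sub>R kmult v"
    using nabla_J_lift_swap[OF q, of a v "jmult q"] by (simp add: P G g0)
  show thesis
  proof (rule that[OF XY(1,3) q])
    show "nabla_J smooth_cp3 (g_cp3 a) J_cp3 X Y (hopf q) \<noteq> 0"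
      unfolding N 1 using assms k by (intro d0 horizontal_scaleR[OF hk]) simp
    assume a: "a \<noteq> 2"
    have "- (2 * (2 / a - 1)) \<noteq> 0" using a assms by (simp add: field_simps)
    then have "dhopf q (nabla_J_lift a q v (jmult q)) + dhopf q (nabla_J_lift a q (jmult q) v) \<noteq> 0"
      unfolding dhopf_add[OF q, symmetric] 2 using k
      by (intro d0 horizontal_scaleR[OF hk]) (simp only: scaleR_eq_0_iff simp_thms)
    then show "nabla_J smooth_cp3 (g_cp3 a) J_cp3 X Y (hopf q) \<noteq> - nabla_J smooth_cp3 (g_cp3 a) J_cp3 Y X (hopf q)"
      unfolding N eq_neg_iff_add_eq_0 .
  qed
qed

theorem theorem3p9:
  shows "(\<forall>a>0. almost_hermitian smooth_cp3 (g_cp3 a) J_cp3 \<and> quasi_kaehler smooth_cp3 (g_cp3 a) J_cp3) \<and>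
         (\<forall>a>0. nearly_kaehler smooth_cp3 (g_cp3 a) J_cp3 \<longleftrightarrow> a = 2) \<and>
         (\<forall>a>0. \<not> kaehler smooth_cp3 (g_cp3 a) J_cp3)"
proof (intro conjI allI impI)
  fix a :: real assume a: "a > 0"
  show herm: "almost_hermitian smooth_cp3 (g_cp3 a) J_cp3" using a by (rule almost_hermitian_cp3)
  show "quasi_kaehler smooth_cp3 (g_cp3 a) J_cp3"
    unfolding quasi_kaehler_def
  proof (intro conjI herm ballI vfield_eqI)
    fix X Y and z :: c4 assume XY: "X \<in> vfields smooth_cp3" "Y \<in> vfields smooth_cp3" and z: "z \<noteq> 0"
    show "(nabla_J smooth_cp3 (g_cp3 a) J_cp3 X Y
        + nabla_J smooth_cp3 (g_cp3 a) J_cp3 (app_endo J_cp3 X) (app_endo J_cp3 Y)) (hopf z) = 0 (hopf z)"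
      using XY z a by (simp add: nabla_J_hopf vfields_app_endo field_lift_app_endo nabla_J_lift_quasi
          field_lift_horizontal dhopf_minus)
  qed
  show "nearly_kaehler smooth_cp3 (g_cp3 a) J_cp3 \<longleftrightarrow> a = 2"
  proof
    assume nk: "nearly_kaehler smooth_cp3 (g_cp3 a) J_cp3"
    obtain X Y z where XY: "X \<in> vfields smooth_cp3" "Y \<in> vfields smooth_cp3"
      and ne: "a \<noteq> 2 \<Longrightarrow> nabla_J smooth_cp3 (g_cp3 a) J_cp3 X Y (hopf z) \<noteq> - nabla_J smooth_cp3 (g_cp3 a) J_cp3 Y X (hopf z)"
      by (rule nabla_J_example[OF a]) blast
    have "nabla_J smooth_cp3 (g_cp3 a) J_cp3 X Y = - nabla_J smooth_cp3 (g_cp3 a) J_cp3 Y X"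
      using nk XY unfolding nearly_kaehler_def by blast
    then show "a = 2" using ne by auto
  next
    assume a2: "a = 2"
    show "nearly_kaehler smooth_cp3 (g_cp3 a) J_cp3"
      unfolding nearly_kaehler_def
    proof (intro conjI herm ballI vfield_eqI)
      fix X Y and z :: c4 assume XY: "X \<in> vfields smooth_cp3" "Y \<in> vfields smooth_cp3" and z: "z \<noteq> 0"
      have "nabla_J_lift a z (field_lift X z) (field_lift Y z) = - nabla_J_lift a z (field_lift Y z) (field_lift X z)"
        using nabla_J_lift_swap[OF z, of a "field_lift X z" "field_lift Y z"]
        by (simp add: a2 eq_neg_iff_add_eq_0)
      then show "nabla_J smooth_cp3 (g_cp3 a) J_cp3 X Y (hopf z) = (- nabla_J smooth_cp3 (g_cp3 a) J_cp3 Y X) (hopf z)"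
        using XY z a by (simp add: nabla_J_hopf dhopf_minus)
    qed
  qed
  show "\<not> kaehler smooth_cp3 (g_cp3 a) J_cp3"
  proof
    assume k: "kaehler smooth_cp3 (g_cp3 a) J_cp3"
    obtain X Y z where XY: "X \<in> vfields smooth_cp3" "Y \<in> vfields smooth_cp3"
      and ne: "nabla_J smooth_cp3 (g_cp3 a) J_cp3 X Y (hopf z) \<noteq> 0"
      by (rule nabla_J_example[OF a]) blast
    have "nabla_J smooth_cp3 (g_cp3 a) J_cp3 X Y = 0"
      using k XY unfolding kaehler_def by blast
    then show False using ne by simp
  qed
qed

end
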